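(* Let $d=1$, let $C=[c_1,c_2]$ with $c_1<c_2$, and assume that $f$ is bounded away from zero on $C$. Assume that: (i) $K$ is a bounded nonnegative function on $\mathbb{R}$ with $\int_{\mathbb{R}}K(z)\,dz=1$, $\int_{\mathbb{R}}zK(z)\,dz=0$, $\int_{\mathbb{R}}z^2|K(z)|\,dz<\infty$, and $K$ is absolutely continuous on $\mathbb{R}$ with $0<\int_{\mathbb{R}}K'^2(t)\,dt<\infty$; (ii) $K$ is Hölder-continuous on $\mathbb{R}$ and satisfies the covering number condition; (iii) $f$ is twice differentiable on $\mathbb{R}$ with $\sup_{x\in\mathbb{R}}|f'(x)|<\infty$ and $\sup_{x\in\mathbb{R}}|f''(x)|<\infty$. Let $h_n=n^{-a}$ with $a\in\left(\frac15,\frac12\right)$ and let $(h_n^* )$ be a sequence of positive real numbers such that $$n^ah_n^*\to\infty\quad\text{and}\quad\frac{n^{1-a}h_n^{*4}}{\log n}\to 0 .$$ Let $\alpha\in(0,1)$, let $z_\alpha$ be defined by $\exp(-2\exp(-z_\alpha))=1-\alpha$, and set, for $n\geq 2$ and $x\in C$, $$u_n=\frac{1}{\sqrt2\log(1/h_n)}\left\{\log\left[\frac{1}{2\pi}\sqrt{\frac{\int_{\mathbb{R}}K'^2(t)\,dt}{\kappa}}\right]+\log\left[\frac{c_2-c_1}{\pi}\right]\right\},$$ $$\ell_n=\sqrt{\log(1/h_n)}\left(\sqrt2+u_n+\frac{z_\alpha}{\sqrt2\log(1/h_n)}\right),$$ $$I_n^*(x)=\left[f_n^*(x)-\frac{\sqrt{f_n(x)\kappa}}{\sqrt{nh_n}}\,\ell_n\,;\,f_n^*(x)+\frac{\sqrt{f_n(x)\kappa}}{\sqrt{nh_n}}\,\ell_n\right].$$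 Then, for each $x\in C$, the logarithmic asymptotic level of $(I_n^*(x))$ is $1$ with speed $h_n^*\log(1/h_n)/h_n$, that is, $$\lim_{n\to\infty}\frac{h_n}{h_n^*\log(1/h_n)}\log\mathbb{P}\left(f(x)\notin I_n^*(x)\right)=-1,$$ and $B_n^*=\cup_{x\in C}I_n^*(x)$ is a confidence band for $f$ on $C$ whose logarithmic asymptotic level is $1$ with speed $h_n^*\log(1/h_n)/h_n$, that is, $$\lim_{n\to\infty}\frac{h_n}{h_n^*\log(1/h_n)}\log\mathbb{P}\left(\exists x\in C,\ f(x)\notin I_n^*(x)\right)=-1 .$$
   Context: Setting: $X_1,X_2,\dots$ are independent identically distributed real random variables with bounded probability density $f$. The kernel $K$ also satisfies $\lim_{|z|\to\infty}K(z)=0$. The kernel density estimators are $$f_n(x)=\frac{1}{nh_n}\sum_{j=1}^nK\left(\frac{x-X_j}{h_n}\right),\qquad f_n^*(x)=\frac{1}{nh_n^{*}}\sum_{j=1}^nK\left(\frac{x-X_j}{h_n^*}\right),$$ and $\kappa=\int_{\mathbb{R}}K^2(z)\,dz$. In the definition of $B_n^*$, $I_n^*(x)$ is identified with the segment $\{x\}\times I_n^*(x)$. Covering number condition: for a probability $Q$ on $\mathbb{R}$ and a class $\mathcal{F}\subset\mathcal{L}_2(Q)$, the covering number $N_2(\epsilon,Q,\mathcal{F})$ is the smallest $m$ for which there exist $g_1,\dots,g_m\in\mathcal{L}_2(Q)$ with $\min_{1\leq i\leq m}\|g-g_i\|_{\mathcal{L}_2(Q)}\leq\epsilon$ for all $g\in\mathcal{F}$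 ($N_2=\infty$ if no such $m$ exists). For a bounded integrable function $\Lambda$ on $\mathbb{R}$ let $\mathcal{F}(\Lambda)=\{z\mapsto\Lambda(\frac{x-z}{h}):\ h>0,\ x\in\mathbb{R}\}$. $\Lambda$ satisfies the covering number condition if there exist $A>0$ and $v>0$ such that, for any probability $Q$ on $\mathbb{R}$ and any $\epsilon\in(0,1)$, $N_2(\epsilon\|\Lambda\|_\infty,Q,\mathcal{F}(\Lambda))\leq(A/\epsilon)^v$. *)

theory Defs
  imports "HOL-Probability.Probability"
begin

definition abs_continuous_on :: "real set \<Rightarrow> (real \<Rightarrow> real) \<Rightarrow> bool" where
  "abs_continuous_on S g \<longleftrightarrow>
     (\<forall>\<epsilon>>0. \<exists>\<delta>>0. \<forall>P :: (real \<times> real) set.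
        finite P \<and> (\<forall>(a, b) \<in> P. a < b \<and> {a..b} \<subseteq> S) \<and>
        pairwise (\<lambda>(a, b) (c, d). {a<..<b} \<inter> {c<..<d} = {}) P \<and>
        (\<Sum>(a, b)\<in>P. b - a) < \<delta>
        \<longrightarrow> (\<Sum>(a, b)\<in>P. \<bar>g b - g a\<bar>) < \<epsilon>)"

definition hoelder_continuous_on :: "real set \<Rightarrow> (real \<Rightarrow> real) \<Rightarrow> bool" where
  "hoelder_continuous_on S g \<longleftrightarrow>
     (\<exists>\<beta> L. 0 < \<beta> \<and> \<beta> \<le> 1 \<and> (\<forall>x\<in>S. \<forall>y\<in>S. \<bar>g x - g y\<bar> \<le> L * \<bar>x - y\<bar> powr \<beta>))"

definition square_integrable :: "real measure \<Rightarrow> (real \<Rightarrow> real) set" where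
  "square_integrable Q = {g \<in> borel_measurable Q. integrable Q (\<lambda>z. (g z)\<^sup>2)}"

definition L2_norm :: "real measure \<Rightarrow> (real \<Rightarrow> real) \<Rightarrow> real" where
  "L2_norm Q g = sqrt (LINT z|Q. (g z)\<^sup>2)"

text \<open>The infimum of the empty set in \<^typ>\<open>enat\<close> is \<open>\<infinity>\<close>.\<close>

definition covering_number :: "real \<Rightarrow> real measure \<Rightarrow> (real \<Rightarrow> real) set \<Rightarrow> enat" where
  "covering_number \<epsilon> Q F =
     Inf {enat m | m. \<exists>g :: nat \<Rightarrow> real \<Rightarrow> real.
            (\<forall>i\<in>{1..m}. g i \<in> square_integrable Q) \<and>
            (\<forall>\<phi>\<in>F. \<exists>i\<in>{1..m}. L2_norm Q (\<lambda>z. \<phi> z - g i z) \<le> \<epsilon>)}"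

definition kernel_class :: "(real \<Rightarrow> real) \<Rightarrow> (real \<Rightarrow> real) set" where
  "kernel_class \<Lambda> = {\<lambda>z. \<Lambda> ((x - z) / h) | x h. h > 0}"

definition covering_number_condition :: "(real \<Rightarrow> real) \<Rightarrow> bool" where
  "covering_number_condition \<Lambda> \<longleftrightarrow>
     (\<exists>A v. A > 0 \<and> v > 0 \<and>
       (\<forall>Q \<epsilon>. prob_space Q \<and> sets Q = sets borel \<and> 0 < \<epsilon> \<and> \<epsilon> < 1 \<longrightarrow>
          kernel_class \<Lambda> \<subseteq> square_integrable Q \<and>
          ereal_of_enat (covering_number (\<epsilon> * (SUP z. \<bar>\<Lambda> z\<bar>)) Q (kernel_class \<Lambda>))
            \<le> ereal ((A / \<epsilon>) powr v)))"

definition kde :: "(real \<Rightarrow> real) \<Rightarrow> real \<Rightarrow> nat \<Rightarrow> (nat \<Rightarrow> real) \<Rightarrow> real \<Rightarrow> real" where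
  "kde K h n X x = 1 / (real n * h) * (\<Sum>j=1..n. K ((x - X j) / h))"

definition kernel_sq :: "(real \<Rightarrow> real) \<Rightarrow> real" where
  "kernel_sq K = (LINT z|lborel. (K z)\<^sup>2)"

text \<open>An absolutely continuous \<open>K\<close> is differentiable almost everywhere; where it is not,
  \<^const>\<open>deriv\<close> takes one fixed value, which affects neither measurability nor the integral.\<close>

definition kernel_deriv_sq :: "(real \<Rightarrow> real) \<Rightarrow> real" where
  "kernel_deriv_sq K = (LINT t|lborel. (deriv K t)\<^sup>2)"

definition band_u :: "(real \<Rightarrow> real) \<Rightarrow> real \<Rightarrow> real \<Rightarrow> real \<Rightarrow> real" where
  "band_u K c1 c2 h =
     1 / (sqrt 2 * ln (1 / h)) *
       (ln (1 / (2 * pi) * sqrt (kernel_deriv_sq K / kernel_sq K)) + ln ((c2 - c1) / pi))"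

definition band_l :: "(real \<Rightarrow> real) \<Rightarrow> real \<Rightarrow> real \<Rightarrow> real \<Rightarrow> real \<Rightarrow> real" where
  "band_l K c1 c2 z h =
     sqrt (ln (1 / h)) * (sqrt 2 + band_u K c1 c2 h + z / (sqrt 2 * ln (1 / h)))"

text \<open>\<open>h\<close> and \<open>hs\<close> are the bandwidths \<open>h\<^sub>n\<close> and \<open>h\<^sub>n\<^sup>*\<close>, \<open>z\<close> is the quantile \<open>z\<^sub>\<alpha>\<close>
  and \<open>X\<close> is the realised sample.\<close>

definition conf_interval ::
  "(real \<Rightarrow> real) \<Rightarrow> real \<Rightarrow> real \<Rightarrow> real \<Rightarrow> real \<Rightarrow> real \<Rightarrow> nat \<Rightarrow> (nat \<Rightarrow> real) \<Rightarrow> real \<Rightarrow> real set" where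
  "conf_interval K c1 c2 z h hs n X x =
     {kde K hs n X x - sqrt (kde K h n X x * kernel_sq K) / sqrt (real n * h) * band_l K c1 c2 z h ..
      kde K hs n X x + sqrt (kde K h n X x * kernel_sq K) / sqrt (real n * h) * band_l K c1 c2 z h}"

definition conf_band ::
  "(real \<Rightarrow> real) \<Rightarrow> real \<Rightarrow> real \<Rightarrow> real \<Rightarrow> real \<Rightarrow> real \<Rightarrow> nat \<Rightarrow> (nat \<Rightarrow> real) \<Rightarrow> (real \<times> real) set" where
  "conf_band K c1 c2 z h hs n X = (\<Union>x\<in>{c1..c2}. {x} \<times> conf_interval K c1 c2 z h hs n X x)"

text \<open>The limits in the theorem are real limits with the convention \<^prop>\<open>ln (0::real) = 0\<close>. Since they
  are nonzero, they force the probabilities to be eventually positive, so they agree with the limits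
  taken with \<open>log 0 = -\<infinity>\<close>.\<close>

end

theory Submission
  imports Defs "HOL-Real_Asymp.Real_Asymp"
begin

text \<open>
  Write \<open>L = log (1/h)\<close>, \<open>\<tau> = sqrt (L / (n h))\<close> and \<open>b = n h\<^sup>* \<tau>\<^sup>2 = h\<^sup>* L / h\<close>. The half-width of the
  interval at \<open>x\<close> is \<open>\<tau> sqrt (2 \<kappa> f(x)) (1 + o(1))\<close>: the other terms of \<open>\<ell>\<close> are of smaller order,
  and the event that \<open>f\<^sub>n\<close> is not close to \<open>f\<close> has probability \<open>exp (- c n h)\<close> with \<open>b = o(n h)\<close>.
  A second-order expansion of exponential moments, uniform in \<open>x\<close>, shows that \<open>n h\<^sup>* \<tau> (f\<^sub>n\<^sup>*(x) - f(x))\<close>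
  has log-moment generating function \<open>b (t\<^sup>2 \<kappa> f(x) / 2 + o(1))\<close> at \<open>t\<close>; the condition on \<open>h\<^sup>*\<close> says
  exactly that the bias \<open>O(h\<^sup>*\<^sup>2)\<close> is \<open>o(\<tau>)\<close>. The Chernoff bound and an exponential tilting then give
  \<open>exp (- b (1 + o(1)))\<close> for the probability of missing \<open>f(x)\<close>. Since \<open>log n = o(b)\<close>, a union bound over
  a grid of polynomially many points costs nothing, and Hoelder continuity of \<open>K\<close> controls the
  estimators between grid points, so that the supremum over \<open>C\<close> has the same exponential rate.
\<close>

section \<open>Real analysis\<close>

text \<open>The width belongs to the scale of the estimator with bandwidth \<open>h\<close>, whereas
  the centre has standard deviation of order 1 / sqrt (n \<open>hs\<close>). The ratio of the two is
  of order sqrt b, so missing f(x) is a moderate deviation. Its Gaussian rate is s^2 / (2 v) with v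
  = kappa f(x), and the half-width s = sqrt (2 v), in units of tau, makes it equal to 1 at every x.
  As the rate is constant over C, one point already attains the rate of the whole band. Two
  estimates therefore suffice: a lower bound at a point and an upper bound over C. The obstacle is
  that the width is itself random. It is frozen outside an event that is negligible against exp (- r
  b) for every fixed r. This is possible because b / (n h) equals a log n times n powr (2 a - 1)
  times \<open>hs\<close>, where a < 1/2 and \<open>hs\<close> tends to 0. The level alpha enters
  the width only through a term of relative size 1 / log (1/h), which does not affect the
  exponential rate.\<close>

lemma exp_cubic_remainder:
  fixes w :: real assumes "\<bar>w\<bar> \<le> 1"
  shows "\<bar>exp w - 1 - w - w\<^sup>2 / 2\<bar> \<le> \<bar>w\<bar> ^ 3"
proof -
  obtain t where t: "\<bar>t\<bar> \<le> \<bar>w\<bar>" "exp w = (\<Sum>m<3. w ^ m / fact m) + exp t / fact 3 * w ^ 3"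
    using Maclaurin_exp_le[of w 3] by blast
  have "exp t \<le> exp 1" using t(1) assms by simp
  also have "\<dots> \<le> 3" by (rule exp_le)
  finally have *: "exp t / 6 \<le> 1" by simp
  have "exp w - 1 - w - w\<^sup>2 / 2 = exp t / 6 * w ^ 3"
    using t(2) by (simp add: eval_nat_numeral fact_numeral)
  also have "\<bar>\<dots>\<bar> = exp t / 6 * \<bar>w\<bar> ^ 3" by (simp add: abs_mult power_abs)
  also have "\<dots> \<le> 1 * \<bar>w\<bar> ^ 3" by (intro mult_right_mono *) simp
  finally show ?thesis by simp
qed

text \<open>The mean value inequality is applied twice, to f' and then to y \<mapsto> f y - y f' x
  on a ball around x. This works for a second derivative that is merely bounded, at the price of B
  in place of B / 2.\<close>

lemma taylor1_bound:
  fixes f f' f'' :: "real \<Rightarrow> real"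
  assumes f: "\<And>x. (f has_real_derivative f' x) (at x)"
    and f': "\<And>x. (f' has_real_derivative f'' x) (at x)" and B: "\<And>x. \<bar>f'' x\<bar> \<le> B"
  shows "\<bar>f (x + d) - f x - d * f' x\<bar> \<le> B * d\<^sup>2"
proof -
  have "0 \<le> B" using B[of 0] by linarith
  have lip: "\<bar>f' y - f' x\<bar> \<le> B * \<bar>y - x\<bar>" for y
    using field_differentiable_bound[of UNIV f' f'' B y x] f' B by auto
  have "norm ((f (x + d) - (x + d) * f' x) - (f x - x * f' x)) \<le> (B * \<bar>d\<bar>) * norm ((x + d) - x)"
  proof (rule field_differentiable_bound[of "cball x \<bar>d\<bar>" _ "\<lambda>y. f' y - f' x"])
    fix y assume "y \<in> cball x \<bar>d\<bar>"
    then have "\<bar>y - x\<bar> \<le> \<bar>d\<bar>" by (auto simp: dist_real_def)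
    then have "B * \<bar>y - x\<bar> \<le> B * \<bar>d\<bar>" using \<open>0 \<le> B\<close> by (rule mult_left_mono)
    then show "norm (f' y - f' x) \<le> B * \<bar>d\<bar>" using lip[of y] by simp
  qed (auto intro!: derivative_eq_intros DERIV_subset[OF f] simp: dist_real_def)
  then show ?thesis by (simp add: algebra_simps power2_eq_square)
qed

section \<open>Hoelder continuity and discretisation of an interval\<close>

lemma hoelder_imp_continuous:
  fixes g :: "real \<Rightarrow> real"
  assumes \<beta>: "0 < \<beta>" and hoelder: "\<And>x y. \<bar>g x - g y\<bar> \<le> L * \<bar>x - y\<bar> powr \<beta>"
  shows "continuous_on UNIV g"
proof -
  have "g \<midarrow>x\<rightarrow> g x" for x
  proof -
    have "((\<lambda>y. \<bar>y - x\<bar>) \<longlongrightarrow> \<bar>x - x\<bar>) (at x)" by (intro tendsto_intros)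
    then have "((\<lambda>y. \<bar>y - x\<bar> powr \<beta>) \<longlongrightarrow> 0 powr \<beta>) (at x)"
      using \<beta> by (intro tendsto_powr') auto
    then have "((\<lambda>y. L * \<bar>y - x\<bar> powr \<beta>) \<longlongrightarrow> L * 0) (at x)" by (intro tendsto_intros) simp
    then have "((\<lambda>y. L * \<bar>y - x\<bar> powr \<beta>) \<longlongrightarrow> 0) (at x)" by simp
    then have "((\<lambda>y. g y - g x) \<longlongrightarrow> 0) (at x)"
      by (rule Lim_null_comparison[rotated]) (simp add: hoelder)
    then show ?thesis by (rule LIM_zero_cancel)
  qed
  then show ?thesis by (simp add: continuous_on_def)
qed

text \<open>The bound is free of the sample \<open>X\<close>. Passing from a point to a neighbour
  therefore costs no probability.\<close>

lemma kde_hoelder: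
  assumes hoelder: "\<And>x y. \<bar>K x - K y\<bar> \<le> L * \<bar>x - y\<bar> powr \<beta>" and n: "1 \<le> n" and S: "0 < S"
  shows "\<bar>kde K S n X x - kde K S n X y\<bar> \<le> L * (\<bar>x - y\<bar> / S) powr \<beta> / S"
proof -
  have "\<bar>(\<Sum>j=1..n. K ((x - X j) / S)) - (\<Sum>j=1..n. K ((y - X j) / S))\<bar>
      \<le> (\<Sum>j=1..n. \<bar>K ((x - X j) / S) - K ((y - X j) / S)\<bar>)"
    unfolding sum_subtractf[symmetric] by (rule sum_abs)
  also have "\<dots> \<le> (\<Sum>j=1..n. L * (\<bar>x - y\<bar> / S) powr \<beta>)"
  proof (rule sum_mono)
    fix j
    have "\<bar>(x - X j) / S - (y - X j) / S\<bar> = \<bar>x - y\<bar> / S"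
      using S by (simp flip: diff_divide_distrib)
    then show "\<bar>K ((x - X j) / S) - K ((y - X j) / S)\<bar> \<le> L * (\<bar>x - y\<bar> / S) powr \<beta>"
      using hoelder[of "(x - X j) / S" "(y - X j) / S"] by simp
  qed
  finally have *: "\<bar>(\<Sum>j=1..n. K ((x - X j) / S)) - (\<Sum>j=1..n. K ((y - X j) / S))\<bar> \<le> n * (L * (\<bar>x - y\<bar> / S) powr \<beta>)"
    by simp
  have "\<bar>kde K S n X x - kde K S n X y\<bar>
    = \<bar>(\<Sum>j=1..n. K ((x - X j) / S)) - (\<Sum>j=1..n. K ((y - X j) / S))\<bar> / (n * S)"
    using S n unfolding kde_def by (simp add: abs_mult flip: diff_divide_distrib)
  also have "\<dots> \<le> n * (L * (\<bar>x - y\<bar> / S) powr \<beta>) / (n * S)"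
    using * S by (intro divide_right_mono) auto
  finally show ?thesis using n by simp
qed

lemma exists_grid_point:
  fixes x c1 c2 :: real
  assumes x: "x \<in> {c1..c2}" and c: "c1 < c2" and N: "0 < N"
  shows "\<exists>i\<in>{0..N}. \<bar>x - (c1 + (c2 - c1) * real i / real N)\<bar> \<le> (c2 - c1) / N"
proof -
  define y where "y = (x - c1) / (c2 - c1) * N"
  have "0 \<le> (x - c1) / (c2 - c1)" "(x - c1) / (c2 - c1) \<le> 1" using x c by auto
  then have y: "0 \<le> y" "y \<le> N"
    unfolding y_def
    using mult_left_le_one_le[of "real N" "(x - c1) / (c2 - c1)"]
      mult_nonneg_nonneg[of "(x - c1) / (c2 - c1)" "real N"] by simp_all
  define i where "i = nat \<lfloor>y\<rfloor>"
  have i: "real i \<le> y" "y - 1 \<le> real i" using y(1) by (auto simp: i_def)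
  have xy: "x = c1 + (c2 - c1) * y / N" using c N by (simp add: y_def)
  have "x - (c1 + (c2 - c1) * real i / real N) = (c2 - c1) / N * (y - i)"
    unfolding xy using N by (simp add: field_simps)
  also have "\<bar>\<dots>\<bar> = (c2 - c1) / N * \<bar>y - i\<bar>" using c by (simp add: abs_mult)
  also have "\<dots> \<le> (c2 - c1) / N * 1" using i c by (intro mult_left_mono) auto
  finally show ?thesis using i y by (intro bexI[of _ i]) auto
qed

text \<open>The logarithm turns both exponential bounds into relative errors of size
  \<open>c * e\<close>. The lower bound also makes \<open>P n\<close> positive, so that the value
  \<open>ln 0 = 0\<close> never enters. The free factor \<open>c\<close> spares the callers from
  normalising their exponents.\<close>

lemma filterlim_log_level:
  fixes b P :: "nat \<Rightarrow> real"
  assumes b: "filterlim b at_top sequentially"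
    and lower: "\<And>e. 0 < e \<Longrightarrow> e < 1 \<Longrightarrow> \<forall>\<^sub>F n in sequentially. exp (- b n * (1 + c * e)) \<le> P n"
    and upper: "\<And>e. 0 < e \<Longrightarrow> e < 1 \<Longrightarrow> \<forall>\<^sub>F n in sequentially. P n \<le> exp (- b n * (1 - c * e))"
    and c: "0 < c"
  shows "(\<lambda>n. 1 / b n * ln (P n)) \<longlonglongrightarrow> -1"
proof (rule tendstoI)
  fix r :: real assume r: "0 < r"
  define e where "e = min (1 / 2) (r / (2 * c))"
  have e: "0 < e" "e < 1" "c * e < r"
    using r c by (auto simp: e_def min_def field_simps)
  have "\<forall>\<^sub>F n in sequentially. 0 < b n" using b by (simp add: filterlim_at_top_dense)
  then show "\<forall>\<^sub>F n in sequentially. dist (1 / b n * ln (P n)) (- 1) < r"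
    using lower[OF e(1,2)] upper[OF e(1,2)]
  proof eventually_elim
    case (elim n)
    have P: "0 < P n" using elim(2) exp_gt_zero[of "- b n * (1 + c * e)"] by linarith
    have "ln (exp (- b n * (1 + c * e))) \<le> ln (P n)" "ln (P n) \<le> ln (exp (- b n * (1 - c * e)))"
      using elim(2,3) P by (simp_all only: ln_le_cancel_iff exp_gt_zero)
    then have "- (1 + c * e) * b n \<le> ln (P n)" "ln (P n) \<le> - (1 - c * e) * b n"
      by (simp_all add: algebra_simps)
    then have "- (1 + c * e) \<le> ln (P n) / b n" "ln (P n) / b n \<le> - (1 - c * e)"
      using elim(1) by (simp_all only: pos_le_divide_eq pos_divide_le_eq)
    then show ?case using e(3) by (simp add: dist_real_def)
  qed
qed

section \<open>Exponential bounds for tails\<close>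

lemma (in prob_space) chernoff_bound:
  assumes [measurable]: "Z \<in> borel_measurable M" and int: "integrable M (\<lambda>\<omega>. exp (t * Z \<omega>))" and t: "0 \<le> t"
  shows "prob {\<omega> \<in> space M. s \<le> Z \<omega>} \<le> exp (- t * s) * expectation (\<lambda>\<omega>. exp (t * Z \<omega>))"
proof -
  have "prob {\<omega> \<in> space M. s \<le> Z \<omega>} \<le> prob {\<omega> \<in> space M. exp (t * s) \<le> exp (t * Z \<omega>)}"
    using t by (intro finite_measure_mono) (auto intro: mult_left_mono)
  also have "\<dots> \<le> expectation (\<lambda>\<omega>. exp (t * Z \<omega>)) / exp (t * s)"
    by (intro integral_Markov_inequality_measure[where A="{}"] int) auto
  finally show ?thesis by (simp add: exp_minus field_simps)
qed

text \<open>Cramer's change of measure, applied to the law of the scalar \<open>Z\<close>: under the weight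
  \<open>exp (t Z)\<close> the variable \<open>Z\<close> concentrates near \<open>b t v\<close>, and the exponential moments at
  \<open>t + x\<close> and \<open>t - x\<close> control the mass outside the window of radius \<open>b g\<close>.\<close>

lemma (in prob_space) tilting_lower_bound:
  assumes [measurable]: "Z \<in> borel_measurable M" and int: "\<And>t. integrable M (\<lambda>\<omega>. exp (t * Z \<omega>))"
    and t: "0 \<le> t" and x: "0 \<le> x"
    and m0: "exp (b * (t\<^sup>2 * v / 2 - e)) \<le> expectation (\<lambda>\<omega>. exp (t * Z \<omega>))"
    and m1: "expectation (\<lambda>\<omega>. exp ((t + x) * Z \<omega>)) \<le> exp (b * ((t + x)\<^sup>2 * v / 2 + e))"
    and m2: "expectation (\<lambda>\<omega>. exp ((t - x) * Z \<omega>)) \<le> exp (b * ((t - x)\<^sup>2 * v / 2 + e))"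
  shows "exp (b * (- t\<^sup>2 * v / 2 - t * g - e)) - 2 * exp (b * (- t\<^sup>2 * v / 2 - t * g + x\<^sup>2 * v / 2 - x * g + e))
    \<le> prob {\<omega> \<in> space M. b * (t * v - g) < Z \<omega>}"
proof -
  define W where "W = {\<omega> \<in> space M. b * (t * v - g) < Z \<omega>}"
  have [measurable]: "W \<in> sets M" unfolding W_def by measurable
  \<comment> \<open>Split by the position of \<open>Z\<close>: above the window,
    \<open>exp (t * Z)\<close> is at most \<open>c1\<close> times the moment at
    \<open>t + x\<close>; below it, at most \<open>c2\<close> times the moment at
    \<open>t - x\<close>; inside it, at most \<open>c3\<close>.\<close>
  define c1 where "c1 = exp (- (x * (b * (t * v + g))))"
  define c2 where "c2 = exp (x * (b * (t * v - g)))"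
  define c3 where "c3 = exp (t * (b * (t * v + g)))"
  have pw: "exp (t * Z \<omega>) \<le> c1 * exp ((t + x) * Z \<omega>) + c2 * exp ((t - x) * Z \<omega>) + c3 * indicator W \<omega>"
    if w: "\<omega> \<in> space M" for \<omega>
  proof -
    have nn: "0 \<le> c1 * exp ((t + x) * Z \<omega>)" "0 \<le> c2 * exp ((t - x) * Z \<omega>)" "0 \<le> c3 * indicator W \<omega>"
      by (auto simp: c1_def c2_def c3_def)
    consider "b * (t * v + g) \<le> Z \<omega>" | "Z \<omega> \<le> b * (t * v - g)" | "\<omega> \<in> W" "Z \<omega> \<le> b * (t * v + g)"
      using w by (force simp: W_def)
    then show ?thesis
    proof cases
      case 1
      have "x * (b * (t * v + g)) \<le> x * Z \<omega>" using 1 x by (rule mult_left_mono)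
      then have "exp (t * Z \<omega>) \<le> c1 * exp ((t + x) * Z \<omega>)"
        by (simp add: c1_def distrib_right flip: exp_add)
      then show ?thesis using nn by linarith
    next
      case 2
      have "x * Z \<omega> \<le> x * (b * (t * v - g))" using 2 x by (rule mult_left_mono)
      then have "exp (t * Z \<omega>) \<le> c2 * exp ((t - x) * Z \<omega>)"
        by (simp add: c2_def left_diff_distrib flip: exp_add)
      then show ?thesis using nn by linarith
    next
      case 3
      have "t * Z \<omega> \<le> t * (b * (t * v + g))" using 3(2) t by (rule mult_left_mono)
      then have "exp (t * Z \<omega>) \<le> c3 * indicator W \<omega>" using 3(1) by (simp add: c3_def)
      then show ?thesis using nn by linarith
    qed
  qed
  have "exp (b * (t\<^sup>2 * v / 2 - e)) \<le> expectation (\<lambda>\<omega>. exp (t * Z \<omega>))" by (rule m0)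
  also have "\<dots> \<le> expectation (\<lambda>\<omega>. c1 * exp ((t + x) * Z \<omega>) + c2 * exp ((t - x) * Z \<omega>) + c3 * indicator W \<omega>)"
    by (intro integral_mono int pw Bochner_Integration.integrable_add integrable_mult_right)
      (auto simp: emeasure_eq_measure)
  also have "\<dots> = c1 * expectation (\<lambda>\<omega>. exp ((t + x) * Z \<omega>)) + c2 * expectation (\<lambda>\<omega>. exp ((t - x) * Z \<omega>)) + c3 * prob W"
    using int by (simp add: emeasure_eq_measure)
  also have "\<dots> \<le> c1 * exp (b * ((t + x)\<^sup>2 * v / 2 + e)) + c2 * exp (b * ((t - x)\<^sup>2 * v / 2 + e)) + c3 * prob W"
    using m1 m2 by (intro add_mono mult_left_mono) (auto simp: c1_def c2_def c3_def)
  \<comment> \<open>The window is symmetric about \<open>b * t * v\<close>, so both outer terms have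
    the same exponent. Its part depending on x is least at x = g / v, the value chosen by the
    caller.\<close>
  also have "c1 * exp (b * ((t + x)\<^sup>2 * v / 2 + e)) = exp (b * (t\<^sup>2 * v / 2 + x\<^sup>2 * v / 2 - x * g + e))"
    by (simp add: c1_def power2_eq_square algebra_simps add_divide_distrib flip: exp_add)
  also have "c2 * exp (b * ((t - x)\<^sup>2 * v / 2 + e)) = exp (b * (t\<^sup>2 * v / 2 + x\<^sup>2 * v / 2 - x * g + e))"
    by (simp add: c2_def power2_eq_square algebra_simps add_divide_distrib diff_divide_distrib flip: exp_add)
  finally have main: "exp (b * (t\<^sup>2 * v / 2 - e)) - 2 * exp (b * (t\<^sup>2 * v / 2 + x\<^sup>2 * v / 2 - x * g + e)) \<le> c3 * prob W"
    by simp
  have "exp (- (t * (b * (t * v + g)))) * (exp (b * (t\<^sup>2 * v / 2 - e)) - 2 * exp (b * (t\<^sup>2 * v / 2 + x\<^sup>2 * v / 2 - x * g + e)))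
    \<le> exp (- (t * (b * (t * v + g)))) * (c3 * prob W)"
    using main by (rule mult_left_mono) simp
  also have "\<dots> = prob W" by (simp add: c3_def flip: exp_add mult.assoc)
  also have "exp (- (t * (b * (t * v + g)))) * (exp (b * (t\<^sup>2 * v / 2 - e)) - 2 * exp (b * (t\<^sup>2 * v / 2 + x\<^sup>2 * v / 2 - x * g + e)))
    = exp (- (t * (b * (t * v + g))) + b * (t\<^sup>2 * v / 2 - e))
      - 2 * exp (- (t * (b * (t * v + g))) + b * (t\<^sup>2 * v / 2 + x\<^sup>2 * v / 2 - x * g + e))"
    by (simp only: exp_add right_diff_distrib mult.left_commute[of _ 2])
  also have "- (t * (b * (t * v + g))) + b * (t\<^sup>2 * v / 2 - e) = b * (- t\<^sup>2 * v / 2 - t * g - e)"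
    by (simp add: power2_eq_square algebra_simps)
  also have "- (t * (b * (t * v + g))) + b * (t\<^sup>2 * v / 2 + x\<^sup>2 * v / 2 - x * g + e)
     = b * (- t\<^sup>2 * v / 2 - t * g + x\<^sup>2 * v / 2 - x * g + e)"
    by (simp add: power2_eq_square algebra_simps)
  finally show ?thesis unfolding W_def .
qed

section \<open>Exponential moments of kernel sums\<close>

text \<open>A single \<open>B\<close> bounds the density, its two derivatives and the kernel. Taking
  it at least 1 lets it dominate constants in the expansion of the logarithm.\<close>

locale kernel_density = prob_space M for M :: "'a measure" +
  fixes X :: "nat \<Rightarrow> 'a \<Rightarrow> real" and f f' f'' K :: "real \<Rightarrow> real" and B :: real
  assumes indep: "indep_vars (\<lambda>_. borel) X {1..}"
    and density: "\<And>j. j \<ge> 1 \<Longrightarrow> distributed M lborel (X j) (\<lambda>x. ennreal (f x))"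
    and f_nonneg: "\<And>x. 0 \<le> f x" and f_le: "\<And>x. f x \<le> B"
    and f'_le: "\<And>x. \<bar>f' x\<bar> \<le> B" and f''_le: "\<And>x. \<bar>f'' x\<bar> \<le> B"
    and f_deriv: "\<And>x. (f has_real_derivative f' x) (at x)"
    and f_deriv2: "\<And>x. (f' has_real_derivative f'' x) (at x)"
    and K_nonneg: "\<And>x. 0 \<le> K x" and K_le: "\<And>x. K x \<le> B"
    and K_int: "has_bochner_integral lborel K 1"
    and K_int1: "has_bochner_integral lborel (\<lambda>x. x * K x) 0"
    and K_int2: "integrable lborel (\<lambda>x. x\<^sup>2 * \<bar>K x\<bar>)"
    and B_ge1: "1 \<le> B"
begin

section \<open>Regularity and integrability\<close>

lemma B_nonneg: "0 \<le> B" and B_pos: "0 < B"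
  using B_ge1 by auto

lemma K_borel [measurable]: "K \<in> borel_measurable borel"
  using borel_measurable_has_bochner_integral[OF K_int] by simp

lemma f_continuous: "continuous_on UNIV f"
  using f_deriv by (meson DERIV_continuous_on has_field_derivative_at_within)

lemma f_borel [measurable]: "f \<in> borel_measurable borel"
  using f_continuous by (rule borel_measurable_continuous_onI)

lemma X_borel [measurable]: "j \<ge> 1 \<Longrightarrow> X j \<in> borel_measurable M"
  using distributed_measurable[OF density] by simp

lemma f_lipschitz: "\<bar>f x - f y\<bar> \<le> B * \<bar>x - y\<bar>"
  using field_differentiable_bound[of UNIV f f' B x y] f_deriv f'_le by auto

lemma integrable_K: "integrable lborel K"
  using K_int by (simp add: has_bochner_integral_iff)

lemma integrable_x2K: "integrable lborel (\<lambda>v. v\<^sup>2 * K v)"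
  using K_int2 K_nonneg by simp

lemma integrable_xK: "integrable lborel (\<lambda>v. \<bar>v\<bar> * K v)"
  using K_int1 integrable_abs[of lborel "\<lambda>x. x * K x"] K_nonneg
  by (simp add: has_bochner_integral_iff abs_mult)

lemma integrable_K2: "integrable lborel (\<lambda>v. (K v)\<^sup>2)"
proof (rule Bochner_Integration.integrable_bound)
  show "integrable lborel (\<lambda>v. B * K v)" using integrable_K by simp
  show "AE v in lborel. norm ((K v)\<^sup>2) \<le> norm (B * K v)"
    using K_nonneg K_le B_nonneg by (intro AE_I2) (simp add: power2_eq_square mult_right_mono)
qed simp

text \<open>A kernel that vanishes almost everywhere could not have integral 1. Positivity is what
  permits division by the variance \<open>kernel_sq K * f x\<close>.\<close>

lemma kernel_sq_pos: "0 < kernel_sq K"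
proof (rule ccontr)
  assume "\<not> 0 < kernel_sq K"
  moreover have "0 \<le> kernel_sq K" unfolding kernel_sq_def by simp
  ultimately have "(LINT v|lborel. (K v)\<^sup>2) = 0" unfolding kernel_sq_def by linarith
  then have "AE v in lborel. (K v)\<^sup>2 = 0"
    using integral_nonneg_eq_0_iff_AE[OF integrable_K2] by simp
  then have "AE v in lborel. K v = 0" by simp
  then have "(LINT v|lborel. K v) = 0" by (simp add: integral_eq_zero_AE)
  then show False using K_int by (simp add: has_bochner_integral_iff)
qed

lemma expectation_kernel:
  assumes "1 \<le> j" "0 < S" and [measurable]: "g \<in> borel_measurable borel"
  shows "expectation (\<lambda>\<omega>. g ((x - X j \<omega>) / S)) = S * (LINT v|lborel. g v * f (x - S * v))"
proof -
  have "expectation (\<lambda>\<omega>. g ((x - X j \<omega>) / S)) = (LINT t|lborel. f t * g ((x - t) / S))"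
    using assms f_nonneg by (subst distributed_integral[OF density]) auto
  also have "\<dots> = \<bar>- S\<bar> *\<^sub>R (LINT v|lborel. f (x + - S * v) * g ((x - (x + - S * v)) / S))"
    using assms by (intro lborel_integral_real_affine) auto
  finally show ?thesis using assms by (simp add: mult.commute)
qed

lemma integrable_mult_f:
  assumes "integrable lborel g"
  shows "integrable lborel (\<lambda>v. g v * f (x - S * v))"
proof (rule Bochner_Integration.integrable_bound)
  have [measurable]: "g \<in> borel_measurable lborel" using assms by auto
  show "(\<lambda>v. g v * f (x - S * v)) \<in> borel_measurable lborel" by measurable
  show "integrable lborel (\<lambda>v. B * g v)" using assms by simp
  show "AE v in lborel. norm (g v * f (x - S * v)) \<le> norm (B * g v)"
    using f_nonneg f_le B_nonneg
    by (intro AE_I2) (auto simp: abs_mult mult.commute[of B] intro!: mult_left_mono)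
qed

section \<open>First and second moments of one kernel term\<close>

definition m1 where "m1 = (LINT v|lborel. \<bar>v\<bar> * K v)"
definition m2 where "m2 = (LINT v|lborel. v\<^sup>2 * K v)"

lemma m1_nonneg: "0 \<le> m1" and m2_nonneg: "0 \<le> m2"
  unfolding m1_def m2_def using K_nonneg by auto

text \<open>The first-order Taylor term integrates to zero because the kernel has mean zero. What
  remains is of relative order S^2, which is the bias of the estimator.\<close>

lemma expectation_K:
  assumes "1 \<le> j" "0 < S"
  shows "\<bar>expectation (\<lambda>\<omega>. K ((x - X j \<omega>) / S)) - S * f x\<bar> \<le> B * m2 * S ^ 3"
proof -
  have i1: "integrable lborel (\<lambda>v. K v * f (x - S * v))" by (rule integrable_mult_f[OF integrable_K])
  have i2: "integrable lborel (\<lambda>v. f x * K v)" using integrable_K by simp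
  have i3: "integrable lborel (\<lambda>v. S * f' x * (v * K v))"
    using K_int1 by (intro integrable_mult_right) (simp add: has_bochner_integral_iff)
  have i4: "integrable lborel (\<lambda>v. (B * S\<^sup>2) * (v\<^sup>2 * K v))"
    using integrable_x2K by (rule integrable_mult_right)
  \<comment> \<open>The added integral is zero. It completes the integrand to the kernel times a
    Taylor remainder at displacement - S v, whence the plus sign.\<close>
  have "(LINT v|lborel. K v * f (x - S * v)) - f x
      = (LINT v|lborel. K v * f (x - S * v)) - (LINT v|lborel. f x * K v) + (LINT v|lborel. S * f' x * (v * K v))"
    using K_int K_int1 by (simp add: has_bochner_integral_iff)
  also have "\<dots> = (LINT v|lborel. K v * f (x - S * v) - f x * K v + S * f' x * (v * K v))" (is "_ = ?J")
    by (simp only: Bochner_Integration.integral_add Bochner_Integration.integral_diff Bochner_Integration.integrable_diff i1 i2 i3)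
  finally have J: "(LINT v|lborel. K v * f (x - S * v)) - f x = ?J" .
  have "\<bar>?J\<bar> \<le> (LINT v|lborel. \<bar>K v * f (x - S * v) - f x * K v + S * f' x * (v * K v)\<bar>)"
    by (rule integral_abs_bound)
  also have "\<dots> \<le> (LINT v|lborel. (B * S\<^sup>2) * (v\<^sup>2 * K v))"
  proof (rule integral_mono)
    show "integrable lborel (\<lambda>v. (B * S\<^sup>2) * (v\<^sup>2 * K v))" by (rule i4)
    show "integrable lborel (\<lambda>v. \<bar>K v * f (x - S * v) - f x * K v + S * f' x * (v * K v)\<bar>)"
      by (intro integrable_abs Bochner_Integration.integrable_add Bochner_Integration.integrable_diff i1 i2 i3)
    fix v
    have "\<bar>f (x + - S * v) - f x - (- S * v) * f' x\<bar> \<le> B * (- S * v)\<^sup>2"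
      by (rule taylor1_bound[OF f_deriv f_deriv2 f''_le])
    then have "K v * \<bar>f (x + - S * v) - f x - (- S * v) * f' x\<bar> \<le> K v * (B * (- S * v)\<^sup>2)"
      using K_nonneg by (rule mult_left_mono)
    moreover have "K v * \<bar>f (x + - S * v) - f x - (- S * v) * f' x\<bar>
       = \<bar>K v * f (x - S * v) - f x * K v + S * f' x * (v * K v)\<bar>"
    proof -
      have "K v * \<bar>f (x + - S * v) - f x - (- S * v) * f' x\<bar>
        = \<bar>K v * (f (x + - S * v) - f x - (- S * v) * f' x)\<bar>"
        using K_nonneg[of v] by (simp only: abs_mult abs_of_nonneg)
      also have "K v * (f (x + - S * v) - f x - (- S * v) * f' x)
        = K v * f (x - S * v) - f x * K v + S * f' x * (v * K v)"
        by (simp add: algebra_simps)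
      finally show ?thesis .
    qed
    ultimately show "\<bar>K v * f (x - S * v) - f x * K v + S * f' x * (v * K v)\<bar> \<le> (B * S\<^sup>2) * (v\<^sup>2 * K v)"
      by (simp add: power_mult_distrib mult_ac)
  qed
  also have "\<dots> = B * S\<^sup>2 * m2" by (simp add: m2_def)
  finally have *: "\<bar>(LINT v|lborel. K v * f (x - S * v)) - f x\<bar> \<le> B * S\<^sup>2 * m2" unfolding J .
  have "\<bar>expectation (\<lambda>\<omega>. K ((x - X j \<omega>) / S)) - S * f x\<bar>
     = S * \<bar>(LINT v|lborel. K v * f (x - S * v)) - f x\<bar>"
    using expectation_kernel[OF assms K_borel, of x] assms
    by (simp add: abs_mult_pos' algebra_simps)
  also have "\<dots> \<le> S * (B * S\<^sup>2 * m2)" using * assms by (intro mult_left_mono) auto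
  finally show ?thesis by (simp add: power2_eq_square power3_eq_cube mult_ac)
qed

text \<open>The square of the kernel need not have mean zero, so only the Lipschitz bound on f is
  available and the error is of order S^2. One factor of the kernel is bounded by \<open>B\<close>,
  which leaves the first absolute moment \<open>m1\<close>. The second, cruder bound serves the
  cubic remainder of the exponential.\<close>

lemma expectation_K2:
  assumes "1 \<le> j" "0 < S"
  shows "\<bar>expectation (\<lambda>\<omega>. (K ((x - X j \<omega>) / S))\<^sup>2) - S * kernel_sq K * f x\<bar> \<le> B\<^sup>2 * m1 * S\<^sup>2"
    and "expectation (\<lambda>\<omega>. (K ((x - X j \<omega>) / S))\<^sup>2) \<le> S * kernel_sq K * B"
proof -
  let ?I = "LINT v|lborel. (K v)\<^sup>2 * f (x - S * v)"
  have E: "expectation (\<lambda>\<omega>. (K ((x - X j \<omega>) / S))\<^sup>2) = S * ?I"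
    using expectation_kernel[of j S "\<lambda>v. (K v)\<^sup>2"] assms by simp
  have i1: "integrable lborel (\<lambda>v. (K v)\<^sup>2 * f (x - S * v))"
    by (rule integrable_mult_f[OF integrable_K2])
  have i2: "integrable lborel (\<lambda>v. (K v)\<^sup>2 * c)" for c using integrable_K2 by simp
  have i4: "integrable lborel (\<lambda>v. (B\<^sup>2 * S) * (\<bar>v\<bar> * K v))"
    using integrable_xK by (rule integrable_mult_right)
  have "?I \<le> (LINT v|lborel. (K v)\<^sup>2 * B)"
    by (rule integral_mono[OF i1 i2]) (simp add: f_le mult_left_mono)
  then have "S * ?I \<le> S * (kernel_sq K * B)" using assms by (simp add: kernel_sq_def)
  then show "expectation (\<lambda>\<omega>. (K ((x - X j \<omega>) / S))\<^sup>2) \<le> S * kernel_sq K * B"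
    using E by simp
  have "?I - kernel_sq K * f x = (LINT v|lborel. (K v)\<^sup>2 * f (x - S * v) - (K v)\<^sup>2 * f x)"
    using i1 i2[of "f x"] by (simp add: kernel_sq_def)
  also have "\<bar>\<dots>\<bar> \<le> (LINT v|lborel. \<bar>(K v)\<^sup>2 * f (x - S * v) - (K v)\<^sup>2 * f x\<bar>)"
    by (rule integral_abs_bound)
  also have "\<dots> \<le> (LINT v|lborel. (B\<^sup>2 * S) * (\<bar>v\<bar> * K v))"
  proof (rule integral_mono[OF _ i4])
    show "integrable lborel (\<lambda>v. \<bar>(K v)\<^sup>2 * f (x - S * v) - (K v)\<^sup>2 * f x\<bar>)"
      using i1 i2[of "f x"] by simp
    fix v
    have "\<bar>(K v)\<^sup>2 * f (x - S * v) - (K v)\<^sup>2 * f x\<bar> = K v * K v * \<bar>f (x - S * v) - f x\<bar>"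
      by (simp add: abs_mult power2_eq_square flip: right_diff_distrib)
    also have "\<dots> \<le> B * K v * (B * \<bar>(x - S * v) - x\<bar>)"
      by (intro mult_mono f_lipschitz) (use K_nonneg K_le B_nonneg in auto)
    also have "\<dots> = (B\<^sup>2 * S) * (\<bar>v\<bar> * K v)" using assms by (simp add: abs_mult power2_eq_square)
    finally show "\<bar>(K v)\<^sup>2 * f (x - S * v) - (K v)\<^sup>2 * f x\<bar> \<le> (B\<^sup>2 * S) * (\<bar>v\<bar> * K v)" .
  qed
  also have "\<dots> = B\<^sup>2 * S * m1" by (simp add: m1_def)
  finally have *: "\<bar>?I - kernel_sq K * f x\<bar> \<le> B\<^sup>2 * S * m1" .
  have "\<bar>S * ?I - S * kernel_sq K * f x\<bar> = S * \<bar>?I - kernel_sq K * f x\<bar>"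
    using assms by (simp add: abs_mult_pos' algebra_simps)
  also have "\<dots> \<le> S * (B\<^sup>2 * S * m1)" using * assms by (intro mult_left_mono) auto
  finally show "\<bar>expectation (\<lambda>\<omega>. (K ((x - X j \<omega>) / S))\<^sup>2) - S * kernel_sq K * f x\<bar> \<le> B\<^sup>2 * m1 * S\<^sup>2"
    using E by (simp add: power2_eq_square mult_ac)
qed

section \<open>Exponential moments of one summand\<close>

lemma integrable_bounded_kernel:
  fixes g :: "real \<Rightarrow> real"
  assumes "1 \<le> j" "\<And>v. 0 \<le> v \<Longrightarrow> v \<le> B \<Longrightarrow> \<bar>g v\<bar> \<le> c" and [measurable]: "g \<in> borel_measurable borel"
  shows "integrable M (\<lambda>\<omega>. g (K ((x - X j \<omega>) / S)))"
proof -
  have [measurable]: "X j \<in> borel_measurable M" using assms by simp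
  show ?thesis
    using assms(2) K_nonneg K_le by (intro integrable_const_bound[where B=c]) auto
qed

text \<open>The exponential is expanded to second order and integrated. The three errors come from
  the bias, from the second moment and from the cubic remainder. The remainder is kept as a multiple
  of the squared kernel, whose expectation is of order S; a constant bound would lose this factor
  S.\<close>

lemma mgf_expansion:
  assumes j: "1 \<le> j" and S: "0 < S" and u: "\<bar>u\<bar> * B \<le> 1"
  shows "\<bar>expectation (\<lambda>\<omega>. exp (u * K ((x - X j \<omega>) / S))) - 1 - u * S * f x - u\<^sup>2 * S * kernel_sq K * f x / 2\<bar>
    \<le> \<bar>u\<bar> * (B * m2 * S ^ 3) + u\<^sup>2 * (B\<^sup>2 * m1 * S\<^sup>2) / 2 + \<bar>u\<bar> ^ 3 * (B * (S * kernel_sq K * B))"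
proof -
  define k where "k \<omega> = K ((x - X j \<omega>) / S)" for \<omega>
  have k: "0 \<le> k \<omega>" "k \<omega> \<le> B" for \<omega> using K_nonneg K_le by (auto simp: k_def)
  have uk: "\<bar>u * k \<omega>\<bar> \<le> 1" for \<omega>
    using mult_left_mono[OF k(2)[of \<omega>], of "\<bar>u\<bar>"] u k(1)[of \<omega>] by (simp add: abs_mult)
  have [measurable]: "X j \<in> borel_measurable M" using j by simp
  have [measurable]: "k \<in> borel_measurable M" unfolding k_def by measurable
  have i1: "integrable M k"
    using k by (intro integrable_const_bound[where B=B]) auto
  have i2: "integrable M (\<lambda>\<omega>. (k \<omega>)\<^sup>2)"
    using k by (intro integrable_const_bound[where B="B\<^sup>2"]) (auto intro: power_mono)
  have i3: "integrable M (\<lambda>\<omega>. exp (u * k \<omega>))"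
    using uk by (intro integrable_const_bound[where B="exp 1"]) (auto simp: abs_le_iff)
  define R where "R \<omega> = exp (u * k \<omega>) - 1 - u * k \<omega> - u\<^sup>2 * (k \<omega>)\<^sup>2 / 2" for \<omega>
  have iR: "integrable M R" unfolding R_def using i1 i2 i3 by simp
  have R: "\<bar>R \<omega>\<bar> \<le> \<bar>u\<bar> ^ 3 * B * (k \<omega>)\<^sup>2" for \<omega>
  proof -
    have "\<bar>R \<omega>\<bar> \<le> \<bar>u * k \<omega>\<bar> ^ 3"
      using exp_cubic_remainder[OF uk[of \<omega>]] by (simp add: R_def power_mult_distrib)
    also have "\<dots> = \<bar>u\<bar> ^ 3 * (k \<omega> * (k \<omega>)\<^sup>2)"
      using k[of \<omega>] by (simp add: abs_mult power_mult_distrib power2_eq_square power3_eq_cube)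
    also have "\<dots> \<le> \<bar>u\<bar> ^ 3 * (B * (k \<omega>)\<^sup>2)"
      using k[of \<omega>] by (intro mult_left_mono mult_right_mono) auto
    finally show ?thesis by (simp add: mult.assoc)
  qed
  have "\<bar>expectation R\<bar> \<le> expectation (\<lambda>\<omega>. \<bar>R \<omega>\<bar>)" by (rule integral_abs_bound)
  also have "\<dots> \<le> expectation (\<lambda>\<omega>. \<bar>u\<bar> ^ 3 * B * (k \<omega>)\<^sup>2)"
    using iR i2 R by (intro integral_mono) auto
  also have "\<dots> = \<bar>u\<bar> ^ 3 * B * expectation (\<lambda>\<omega>. (k \<omega>)\<^sup>2)" by simp
  also have "\<dots> \<le> \<bar>u\<bar> ^ 3 * B * (S * kernel_sq K * B)"
    using expectation_K2(2)[OF j S, of x] B_nonneg by (intro mult_left_mono) (auto simp: k_def)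
  finally have ER: "\<bar>expectation R\<bar> \<le> \<bar>u\<bar> ^ 3 * (B * (S * kernel_sq K * B))" by (simp add: mult.assoc)
  have "expectation R = expectation (\<lambda>\<omega>. exp (u * k \<omega>)) - 1 - u * expectation k
      - u\<^sup>2 * expectation (\<lambda>\<omega>. (k \<omega>)\<^sup>2) / 2"
    unfolding R_def using i1 i2 i3 by (simp add: prob_space)
  then have eq: "expectation (\<lambda>\<omega>. exp (u * k \<omega>)) - 1 - u * S * f x - u\<^sup>2 * S * kernel_sq K * f x / 2
     = expectation R + u * (expectation k - S * f x)
      + u\<^sup>2 * (expectation (\<lambda>\<omega>. (k \<omega>)\<^sup>2) - S * kernel_sq K * f x) / 2"
    by (simp add: right_diff_distrib diff_divide_distrib mult.assoc)
  have "\<bar>u * (expectation k - S * f x)\<bar> \<le> \<bar>u\<bar> * (B * m2 * S ^ 3)"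
    using expectation_K[OF j S, of x] by (simp add: abs_mult k_def[abs_def] mult_left_mono)
  moreover have "\<bar>u\<^sup>2 * (expectation (\<lambda>\<omega>. (k \<omega>)\<^sup>2) - S * kernel_sq K * f x) / 2\<bar> \<le> u\<^sup>2 * (B\<^sup>2 * m1 * S\<^sup>2) / 2"
    using expectation_K2(1)[OF j S, of x] by (simp add: abs_mult k_def mult_left_mono)
  ultimately have "\<bar>expectation (\<lambda>\<omega>. exp (u * k \<omega>)) - 1 - u * S * f x - u\<^sup>2 * S * kernel_sq K * f x / 2\<bar>
    \<le> \<bar>u\<bar> * (B * m2 * S ^ 3) + u\<^sup>2 * (B\<^sup>2 * m1 * S\<^sup>2) / 2 + \<bar>u\<bar> ^ 3 * (B * (S * kernel_sq K * B))"
    unfolding eq using ER by linarith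
  then show ?thesis unfolding k_def .
qed

lemma expectation_exp_pos:
  assumes "1 \<le> j"
  shows "0 < expectation (\<lambda>\<omega>. exp (u * K ((x - X j \<omega>) / S)))"
proof -
  have "exp (- (\<bar>u\<bar> * B)) = expectation (\<lambda>\<omega>. exp (- (\<bar>u\<bar> * B)))" by (simp add: prob_space)
  also have "\<dots> \<le> expectation (\<lambda>\<omega>. exp (u * K ((x - X j \<omega>) / S)))"
  proof (rule integral_mono)
    have le: "\<bar>u * k\<bar> \<le> \<bar>u\<bar> * B" if "0 \<le> k" "k \<le> B" for k
      using that by (simp add: abs_mult mult_left_mono)
    show "integrable M (\<lambda>\<omega>. exp (u * K ((x - X j \<omega>) / S)))"
      using le by (intro integrable_bounded_kernel[where g = "\<lambda>v. exp (u * v)" and c = "exp (\<bar>u\<bar> * B)"] assms)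
        (auto simp: abs_le_iff)
    show "exp (- (\<bar>u\<bar> * B)) \<le> exp (u * K ((x - X j \<omega>) / S))" for \<omega>
      using le[OF K_nonneg K_le, of "(x - X j \<omega>) / S"] by (simp add: abs_le_iff)
  qed simp
  finally show ?thesis using exp_gt_zero[of "- (\<bar>u\<bar> * B)"] by linarith
qed

text \<open>With E the expectation, ln E = (E - 1) + O((E - 1)^2), and E - 1 is O(|u| S); the
  logarithm thus adds an error u^2 S^2 only. All constants come from \<open>B\<close> and the
  moments of the kernel, hence the uniformity in x.\<close>

lemma log_mgf_expansion:
  "\<exists>C u0. 0 < u0 \<and> 0 \<le> C \<and> (\<forall>u S x. \<bar>u\<bar> \<le> u0 \<longrightarrow> 0 < S \<longrightarrow> S \<le> 1 \<longrightarrow>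
     \<bar>ln (expectation (\<lambda>\<omega>. exp (u * K ((x - X 1 \<omega>) / S)))) - u * S * f x - u\<^sup>2 * S * kernel_sq K * f x / 2\<bar>
     \<le> C * (\<bar>u\<bar> * S ^ 3 + u\<^sup>2 * S\<^sup>2 + \<bar>u\<bar> ^ 3 * S))"
proof -
  define kp where "kp = kernel_sq K"
  \<comment> \<open>The summands are the coefficients of the linear term, the quadratic term and the
    three errors, so that |E - 1| is at most |u| A S.\<close>
  define A where "A = B + B * kp + B * m2 + B\<^sup>2 * m1 + B\<^sup>2 * kp"
  have kp: "0 < kp" using kernel_sq_pos by (simp add: kp_def)
  note nn = B_nonneg m1_nonneg m2_nonneg kp
  have parts: "0 \<le> B * kp" "0 \<le> B * m2" "0 \<le> B\<^sup>2 * m1" "0 \<le> B\<^sup>2 * kp" using nn by auto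
  have A: "B \<le> A" "1 \<le> A" "B * m2 \<le> A" "B\<^sup>2 * m1 \<le> A" "B\<^sup>2 * kp \<le> A"
    using parts B_ge1 by (auto simp: A_def)
  show ?thesis
  \<comment> \<open>The constant is A from the expansion of E plus 2 A^2 from the logarithm. The
    bound 1 / (2 A) on |u| keeps |E - 1| below 1 / 2, where the estimate of the logarithm
    applies.\<close>
  proof (rule exI[of _ "A + 2 * A\<^sup>2"], rule exI[of _ "1 / (2 * A)"], intro conjI allI impI)
    show "0 < 1 / (2 * A)" "0 \<le> A + 2 * A\<^sup>2" using A by auto
    fix u S x :: real assume u: "\<bar>u\<bar> \<le> 1 / (2 * A)" and S: "0 < S" "S \<le> 1"
    have uA: "\<bar>u\<bar> * A \<le> 1 / 2" using mult_right_mono[OF u, of A] A by simp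
    have "\<bar>u\<bar> * 1 \<le> \<bar>u\<bar> * A" "\<bar>u\<bar> * B \<le> \<bar>u\<bar> * A" by (intro mult_left_mono A abs_ge_zero)+
    then have u1: "\<bar>u\<bar> \<le> 1" and uB: "\<bar>u\<bar> * B \<le> 1" using uA by auto
    define E where "E = expectation (\<lambda>\<omega>. exp (u * K ((x - X 1 \<omega>) / S)))"
    define T where "T = \<bar>u\<bar> * (B * m2 * S ^ 3) + u\<^sup>2 * (B\<^sup>2 * m1 * S\<^sup>2) / 2 + \<bar>u\<bar> ^ 3 * (B * (S * kp * B))"
    have E: "\<bar>E - 1 - u * S * f x - u\<^sup>2 * S * kp * f x / 2\<bar> \<le> T"
      unfolding E_def T_def kp_def by (rule mgf_expansion) (use S uB in auto)
    have t1: "\<bar>u\<bar> * (B * m2 * S ^ 3) \<le> A * (\<bar>u\<bar> * S ^ 3)"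
      using mult_right_mono[OF A(3), of "\<bar>u\<bar> * S ^ 3"] S by (simp add: mult_ac)
    have "u\<^sup>2 * (B\<^sup>2 * m1 * S\<^sup>2) / 2 \<le> u\<^sup>2 * (B\<^sup>2 * m1 * S\<^sup>2)" using nn by simp
    also have "\<dots> \<le> A * (u\<^sup>2 * S\<^sup>2)"
      using mult_right_mono[OF A(4), of "u\<^sup>2 * S\<^sup>2"] by (simp add: mult_ac)
    finally have t2: "u\<^sup>2 * (B\<^sup>2 * m1 * S\<^sup>2) / 2 \<le> A * (u\<^sup>2 * S\<^sup>2)" .
    have t3: "\<bar>u\<bar> ^ 3 * (B * (S * kp * B)) \<le> A * (\<bar>u\<bar> ^ 3 * S)"
      using mult_right_mono[OF A(5), of "\<bar>u\<bar> ^ 3 * S"] S by (simp add: mult_ac power2_eq_square)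
    have T: "T \<le> A * (\<bar>u\<bar> * S ^ 3 + u\<^sup>2 * S\<^sup>2 + \<bar>u\<bar> ^ 3 * S)"
      unfolding T_def using t1 t2 t3 by (simp add: algebra_simps)
    \<comment> \<open>For the coarse bound on |E - 1| all powers are reduced to |u| S; the finer
      powers survive only in the bound on \<open>T\<close>.\<close>
    have p: "S ^ 3 \<le> S" "S\<^sup>2 \<le> S" using S power_decreasing[of 1 3 S] power_decreasing[of 1 2 S] by auto
    have v: "\<bar>u\<bar> ^ 3 \<le> \<bar>u\<bar>" "u\<^sup>2 \<le> \<bar>u\<bar>" 
      using u1 power_decreasing[of 1 3 "\<bar>u\<bar>"] power_decreasing[of 1 2 "\<bar>u\<bar>"] by auto
    have s1: "\<bar>u\<bar> * (B * m2 * S ^ 3) \<le> \<bar>u\<bar> * (B * m2 * S)"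
      using p nn by (intro mult_left_mono) auto
    have s2: "u\<^sup>2 * (B\<^sup>2 * m1 * S\<^sup>2) / 2 \<le> \<bar>u\<bar> * (B\<^sup>2 * m1 * S)"
    proof -
      have "u\<^sup>2 * (B\<^sup>2 * m1 * S\<^sup>2) / 2 \<le> u\<^sup>2 * (B\<^sup>2 * m1 * S\<^sup>2)" using nn by simp
      also have "\<dots> \<le> \<bar>u\<bar> * (B\<^sup>2 * m1 * S)" using p v nn S by (intro mult_mono mult_left_mono) auto
      finally show ?thesis .
    qed
    have s3: "\<bar>u\<bar> ^ 3 * (B * (S * kp * B)) \<le> \<bar>u\<bar> * (B\<^sup>2 * kp * S)"
      using mult_right_mono[OF v(1), of "B\<^sup>2 * kp * S"] nn S by (simp add: power2_eq_square mult_ac)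
    have s4: "\<bar>u * S * f x\<bar> \<le> \<bar>u\<bar> * (B * S)"
      using mult_left_mono[OF f_le[of x], of "\<bar>u\<bar> * S"] S f_nonneg[of x] by (simp add: abs_mult mult_ac)
    have s5: "\<bar>u\<^sup>2 * S * kp * f x / 2\<bar> \<le> \<bar>u\<bar> * (B * kp * S)"
    proof -
      have "\<bar>u\<^sup>2 * S * kp * f x / 2\<bar> = u\<^sup>2 * (S * kp * f x / 2)"
        using S f_nonneg[of x] kp by (simp add: abs_mult)
      also have "S * kp * f x / 2 \<le> S * kp * f x" using S f_nonneg[of x] kp by simp
      then have "u\<^sup>2 * (S * kp * f x / 2) \<le> \<bar>u\<bar> * (S * kp * B)"
        using v(2) S f_nonneg[of x] kp mult_left_mono[OF f_le[of x], of "S * kp"] by (intro mult_mono) auto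
      finally show ?thesis by (simp add: mult_ac)
    qed
    have "\<bar>E - 1\<bar> \<le> \<bar>u * S * f x\<bar> + \<bar>u\<^sup>2 * S * kp * f x / 2\<bar> + T" using E by linarith
    also have "\<dots> \<le> \<bar>u\<bar> * (B * S) + \<bar>u\<bar> * (B * kp * S)
        + (\<bar>u\<bar> * (B * m2 * S) + \<bar>u\<bar> * (B\<^sup>2 * m1 * S) + \<bar>u\<bar> * (B\<^sup>2 * kp * S))"
      using s1 s2 s3 s4 s5 unfolding T_def by linarith
    also have "\<dots> = (\<bar>u\<bar> * A) * S" by (simp add: A_def algebra_simps)
    finally have y: "\<bar>E - 1\<bar> \<le> \<bar>u\<bar> * A * S" .
    also have "\<dots> \<le> 1 / 2 * 1" using uA S A by (intro mult_mono) auto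
    finally have y2: "\<bar>E - 1\<bar> \<le> 1 / 2" by simp
    have "\<bar>ln E - (E - 1)\<bar> \<le> 2 * (E - 1)\<^sup>2"
      using abs_ln_one_plus_x_minus_x_bound[OF y2] by simp
    also have "(E - 1)\<^sup>2 \<le> (\<bar>u\<bar> * A * S)\<^sup>2" using power_mono[OF y abs_ge_zero, of 2] by simp
    finally have "\<bar>ln E - (E - 1)\<bar> \<le> 2 * A\<^sup>2 * (u\<^sup>2 * S\<^sup>2)" by (simp add: power_mult_distrib mult_ac)
    also have "\<dots> \<le> 2 * A\<^sup>2 * (\<bar>u\<bar> * S ^ 3 + u\<^sup>2 * S\<^sup>2 + \<bar>u\<bar> ^ 3 * S)"
      using S by (intro mult_left_mono) auto
    finally have "\<bar>ln E - u * S * f x - u\<^sup>2 * S * kp * f x / 2\<bar>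
       \<le> 2 * A\<^sup>2 * (\<bar>u\<bar> * S ^ 3 + u\<^sup>2 * S\<^sup>2 + \<bar>u\<bar> ^ 3 * S) + A * (\<bar>u\<bar> * S ^ 3 + u\<^sup>2 * S\<^sup>2 + \<bar>u\<bar> ^ 3 * S)"
      using E T by linarith
    then show "\<bar>ln (expectation (\<lambda>\<omega>. exp (u * K ((x - X 1 \<omega>) / S)))) - u * S * f x - u\<^sup>2 * S * kernel_sq K * f x / 2\<bar>
     \<le> (A + 2 * A\<^sup>2) * (\<bar>u\<bar> * S ^ 3 + u\<^sup>2 * S\<^sup>2 + \<bar>u\<bar> ^ 3 * S)"
      unfolding E_def kp_def by (simp add: distrib_right add.commute)
  qed
qed

text \<open>The sum is centred at the target S f(x) and not at its expectation, so that the bias is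
  treated as an error in the exponent.\<close>

definition dev :: "nat \<Rightarrow> real \<Rightarrow> real \<Rightarrow> 'a \<Rightarrow> real" where
  "dev n S x \<omega> = (\<Sum>j=1..n. K ((x - X j \<omega>) / S) - S * f x)"

lemma dev_eq_kde:
  assumes "1 \<le> n" "0 < S"
  shows "dev n S x \<omega> = n * S * (kde K S n (\<lambda>j. X j \<omega>) x - f x)"
  using assms unfolding dev_def kde_def by (simp add: sum_subtractf field_simps)

lemma dev_borel [measurable]: "dev n S x \<in> borel_measurable M"
proof -
  have "(\<lambda>\<omega>. K ((x - X j \<omega>) / S) - S * f x) \<in> borel_measurable M" if "j \<in> {1..n}" for j
  proof -
    have [measurable]: "X j \<in> borel_measurable M" using that by simp
    show ?thesis by measurable
  qed
  then show ?thesis unfolding dev_def[abs_def] by (rule borel_measurable_sum)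
qed

lemma integrable_exp_dev: "integrable M (\<lambda>\<omega>. exp (u * dev n S x \<omega>))"
proof (rule integrable_const_bound)
  have "\<bar>u * dev n S x \<omega>\<bar> \<le> \<bar>u\<bar> * (n * (B + \<bar>S\<bar> * B))" for \<omega>
  proof -
    have "\<bar>K ((x - X j \<omega>) / S) - S * f x\<bar> \<le> B + \<bar>S\<bar> * B" for j
    proof -
      have "\<bar>S * f x\<bar> \<le> \<bar>S\<bar> * B"
        using f_nonneg f_le by (simp add: abs_mult mult_left_mono)
      then show ?thesis using K_nonneg[of "(x - X j \<omega>) / S"] K_le[of "(x - X j \<omega>) / S"] by linarith
    qed
    then have "\<bar>dev n S x \<omega>\<bar> \<le> (\<Sum>j=1..n. B + \<bar>S\<bar> * B)"
      unfolding dev_def by (intro order_trans[OF sum_abs sum_mono])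
    then show ?thesis by (simp add: abs_mult mult_left_mono)
  qed
  then show "AE \<omega> in M. norm (exp (u * dev n S x \<omega>)) \<le> exp (\<bar>u\<bar> * (n * (B + \<bar>S\<bar> * B)))"
    by (auto simp: abs_le_iff)
qed simp

text \<open>Independence gives an n-th power. It is written through the logarithm so that
  \<open>log_mgf_expansion\<close> applies; the subtracted \<open>u * S * f x\<close> cancels its
  linear term.\<close>

lemma expectation_exp_dev:
  assumes "0 < S"
  shows "expectation (\<lambda>\<omega>. exp (u * dev n S x \<omega>))
    = exp (n * (ln (expectation (\<lambda>\<omega>. exp (u * K ((x - X 1 \<omega>) / S)))) - u * S * f x))"
proof -
  let ?g = "\<lambda>y. exp (u * (K ((x - y) / S) - S * f x))"
  let ?E = "expectation (\<lambda>\<omega>. exp (u * K ((x - X 1 \<omega>) / S)))"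
  have ind: "indep_vars (\<lambda>_. borel) (\<lambda>j \<omega>. ?g (X j \<omega>)) {1..n}"
    by (rule indep_vars_compose2[where M' = "\<lambda>_. borel"]) (auto intro!: indep_vars_subset[OF indep])
  have E: "expectation (\<lambda>\<omega>. exp (u * K ((x - X j \<omega>) / S))) = ?E" if "1 \<le> j" for j
    using expectation_kernel[OF that assms, of "\<lambda>v. exp (u * K v)" x]
      expectation_kernel[OF order_refl assms, of "\<lambda>v. exp (u * K v)" x] by simp
  have int: "integrable M (\<lambda>\<omega>. exp (u * (K ((x - X j \<omega>) / S) - S * f x)))" if j: "1 \<le> j" for j
  proof -
    have "\<bar>exp (u * (v - S * f x))\<bar> \<le> exp (\<bar>u\<bar> * (B + \<bar>S * f x\<bar>))" if "0 \<le> v" "v \<le> B" for v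
    proof -
      have "u * (v - S * f x) \<le> \<bar>u * (v - S * f x)\<bar>" by simp
      also have "\<dots> \<le> \<bar>u\<bar> * (B + \<bar>S * f x\<bar>)"
        unfolding abs_mult[of u] using that by (intro mult_left_mono) auto
      finally show ?thesis by simp
    qed
    then show ?thesis
      by (intro integrable_bounded_kernel[where g = "\<lambda>v. exp (u * (v - S * f x))"]) (use j in auto)
  qed
  have "expectation (\<lambda>\<omega>. exp (u * dev n S x \<omega>)) = expectation (\<lambda>\<omega>. \<Prod>j\<in>{1..n}. ?g (X j \<omega>))"
    unfolding dev_def by (simp add: sum_distrib_left exp_sum)
  also have "\<dots> = (\<Prod>j\<in>{1..n}. expectation (\<lambda>\<omega>. ?g (X j \<omega>)))"
    using int by (intro indep_vars_lebesgue_integral ind) auto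
  also have "\<dots> = (\<Prod>j\<in>{1..n}. ?E * exp (- (u * S * f x)))"
  proof (rule prod.cong)
    fix j assume "j \<in> {1..n}"
    have "?g (X j \<omega>) = exp (u * K ((x - X j \<omega>) / S)) * exp (- (u * S * f x))" for \<omega>
      by (simp add: right_diff_distrib mult.assoc flip: exp_add)
    then show "expectation (\<lambda>\<omega>. ?g (X j \<omega>)) = ?E * exp (- (u * S * f x))"
      using E[of j] \<open>j \<in> {1..n}\<close> by simp
  qed simp
  also have "\<dots> = (?E * exp (- (u * S * f x))) ^ n" by simp
  also have "?E * exp (- (u * S * f x)) = exp (ln ?E - u * S * f x)"
    using expectation_exp_pos[of 1 u x S] by (simp add: exp_diff exp_minus divide_inverse)
  also have "\<dots> ^ n = exp (n * (ln ?E - u * S * f x))" by (simp add: exp_of_nat_mult)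
  finally show ?thesis .
qed

end

section \<open>Bandwidths\<close>

locale bandwidths =
  fixes a :: real and hs :: "nat \<Rightarrow> real"
  assumes a: "0 < a" "a < 1 / 2"
    and hs_pos: "\<And>n. n \<ge> 1 \<Longrightarrow> hs n > 0"
    and hs_lower: "filterlim (\<lambda>n. real n powr a * hs n) at_top sequentially"
    and hs_upper: "(\<lambda>n. real n powr (1 - a) * hs n ^ 4 / ln (real n)) \<longlonglongrightarrow> 0"
begin

text \<open>The scales are given as explicit powers of n, so that most limits are elementary;
  \<open>tau_alt\<close>, \<open>b_eq\<close> and \<open>b_eq'\<close> restore their meaning. At n =
  1 the logarithm makes \<open>tau\<close> and \<open>b\<close> vanish, hence the threshold 2 in
  their positivity.\<close>

definition h :: "nat \<Rightarrow> real" where "h n = real n powr - a"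
definition tau :: "nat \<Rightarrow> real" where "tau n = sqrt (a * ln n * real n powr (a - 1))"
definition b :: "nat \<Rightarrow> real" where "b n = a * ln n * hs n * real n powr a"

lemma ev_ge: "\<forall>\<^sub>F n in sequentially. (k::nat) \<le> n"
  by (rule eventually_ge_at_top)

lemma h_pos: "1 \<le> n \<Longrightarrow> 0 < h n"
  by (simp add: h_def)

lemma h_lim: "h \<longlonglongrightarrow> 0"
  unfolding h_def[abs_def] using a by real_asymp

lemma nh: "1 \<le> n \<Longrightarrow> n * h n = real n powr (1 - a)"
  by (simp add: h_def powr_diff powr_minus divide_inverse)

lemma ln_inverse_h: "1 \<le> n \<Longrightarrow> ln (1 / h n) = a * ln n"
  by (simp add: h_def ln_div ln_powr)

lemma tau_pos: "2 \<le> n \<Longrightarrow> 0 < tau n"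
  using a by (simp add: tau_def)

lemma tau_sq: "1 \<le> n \<Longrightarrow> (tau n)\<^sup>2 = a * ln n * real n powr (a - 1)"
  using a by (simp add: tau_def)

lemma tau_lim: "tau \<longlonglongrightarrow> 0"
  unfolding tau_def[abs_def] using a by real_asymp

lemma tau_alt: "1 \<le> n \<Longrightarrow> tau n = sqrt (ln (1 / h n)) / sqrt (n * h n)"
  unfolding ln_inverse_h nh tau_def real_sqrt_divide[symmetric]
  by (simp add: powr_diff field_simps)

lemma b_eq: "1 \<le> n \<Longrightarrow> b n = n * hs n * (tau n)\<^sup>2"
  by (simp add: tau_sq b_def powr_diff field_simps)

lemma b_eq': "1 \<le> n \<Longrightarrow> h n / (hs n * ln (1 / h n)) = 1 / b n"
  unfolding ln_inverse_h by (simp add: b_def h_def powr_minus field_simps)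

lemma b_pos: "2 \<le> n \<Longrightarrow> 0 < b n"
  using a hs_pos[of n] by (simp add: b_def)

lemma b_lim: "filterlim b at_top sequentially"
proof -
  have "filterlim (\<lambda>n. (a * ln (real n)) * (real n powr a * hs n)) at_top sequentially"
    by (rule filterlim_at_top_mult_at_top[OF _ hs_lower]) (use a in real_asymp)
  then show ?thesis by (simp add: b_def[abs_def] mult_ac)
qed

text \<open>For n at least 2 the inverse ratio is exactly a times
  \<open>real n powr a * hs n\<close>, which \<open>hs_lower\<close> sends to infinity.\<close>

lemma ln_over_b: "(\<lambda>n. ln n / b n) \<longlonglongrightarrow> 0"
proof -
  have "(\<lambda>n. 1 / a * inverse (real n powr a * hs n)) \<longlonglongrightarrow> 1 / a * 0"
    by (intro tendsto_mult tendsto_const filterlim_compose[OF tendsto_inverse_0]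
        filterlim_mono[OF hs_lower at_top_le_at_infinity order_refl])
  moreover have "\<forall>\<^sub>F n in sequentially. 1 / a * inverse (real n powr a * hs n) = ln n / b n"
    using ev_ge[of 2]
  proof eventually_elim
    case (elim n)
    then have "ln (real n) \<noteq> 0" by simp
    then show ?case by (simp add: b_def field_simps)
  qed
  ultimately show ?thesis by (simp add: tendsto_cong)
qed

text \<open>The fourth power of \<open>hs n\<close> is the quotient in \<open>hs_upper\<close> times
  ln n / n powr (1 - a), and both factors tend to 0.\<close>

lemma hs_lim: "hs \<longlonglongrightarrow> 0"
proof -
  have "(\<lambda>n. (real n powr (1 - a) * hs n ^ 4 / ln (real n)) * (ln n / real n powr (1 - a))) \<longlonglongrightarrow> 0 * 0"
    by (intro tendsto_mult hs_upper) (use a in real_asymp)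
  moreover have "\<forall>\<^sub>F n in sequentially.
    (real n powr (1 - a) * hs n ^ 4 / ln (real n)) * (ln n / real n powr (1 - a)) = hs n ^ 4"
    using ev_ge[of 2]
  proof eventually_elim
    case (elim n)
    then have "ln (real n) \<noteq> 0" by simp
    then show ?case using elim by (simp add: field_simps)
  qed
  ultimately have "(\<lambda>n. hs n ^ 4) \<longlonglongrightarrow> 0" by (simp add: tendsto_cong)
  then have "(\<lambda>n. root 4 (hs n ^ 4)) \<longlonglongrightarrow> root 4 0" by (rule tendsto_real_root)
  moreover have "\<forall>\<^sub>F n in sequentially. root 4 (hs n ^ 4) = hs n"
    using ev_ge[of 1] by eventually_elim (use hs_pos in \<open>simp add: real_root_power_cancel less_imp_le\<close>)
  ultimately show ?thesis by (simp add: tendsto_cong)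
qed

text \<open>For n at least 2 the ratio is the square root of 1 / a times the quotient in
  \<open>hs_upper\<close>.\<close>

lemma bias_negligible: "(\<lambda>n. (hs n)\<^sup>2 / tau n) \<longlonglongrightarrow> 0"
proof -
  have "(\<lambda>n. sqrt (1 / a * (real n powr (1 - a) * hs n ^ 4 / ln (real n)))) \<longlonglongrightarrow> sqrt (1 / a * 0)"
    by (intro tendsto_intros hs_upper)
  moreover have "\<forall>\<^sub>F n in sequentially.
     sqrt (1 / a * (real n powr (1 - a) * hs n ^ 4 / ln (real n))) = (hs n)\<^sup>2 / tau n"
    using ev_ge[of 2]
  proof eventually_elim
    case (elim n)
    have "1 / a * (real n powr (1 - a) * hs n ^ 4 / ln (real n)) = ((hs n)\<^sup>2 / tau n)\<^sup>2"
      using elim a by (simp add: power_divide tau_sq powr_diff field_simps flip: power_mult)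
    then show ?case using tau_pos[OF elim] by simp
  qed
  ultimately show ?thesis by (simp add: tendsto_cong)
qed

lemma b_over_nh: "(\<lambda>n. b n / (n * h n)) \<longlonglongrightarrow> 0"
proof -
  have "(\<lambda>n. (a * ln n * real n powr (2 * a - 1)) * hs n) \<longlonglongrightarrow> 0 * 0"
    by (intro tendsto_mult hs_lim) (use a in real_asymp)
  moreover have "\<forall>\<^sub>F n in sequentially. (a * ln n * real n powr (2 * a - 1)) * hs n = b n / (n * h n)"
    using ev_ge[of 1]
  proof eventually_elim
    case (elim n)
    have "real n powr (2 * a - 1) = real n powr a / real n powr (1 - a)"
      by (simp flip: powr_diff)
    then show ?case unfolding nh[OF elim] by (simp add: b_def)
  qed
  ultimately show ?thesis by (simp add: tendsto_cong)
qed

lemma inverse_square_over_tau: "(\<lambda>n. c / (real n)\<^sup>2 / tau n) \<longlonglongrightarrow> 0"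
  unfolding tau_def[abs_def] using a by real_asymp

text \<open>A grid that is fine enough for the bandwidth \<open>h\<close> then serves
  \<open>hs\<close> as well.\<close>

lemma hs_ge: "\<forall>\<^sub>F n in sequentially. h n \<le> hs n"
  using filterlim_at_top[THEN iffD1, OF hs_lower, rule_format, of 1] ev_ge[of 1]
proof eventually_elim
  case (elim n)
  then show ?case by (simp add: h_def powr_minus field_simps)
qed

end

section \<open>Moderate deviations of the estimators\<close>

locale kernel_density_bandwidths = kernel_density M X f f' f'' K B + bandwidths a hs
  for M :: "'a measure" and X f f' f'' K B a hs
begin

abbreviation est :: "(nat \<Rightarrow> real) \<Rightarrow> nat \<Rightarrow> 'a \<Rightarrow> real \<Rightarrow> real" where
  "est H n \<omega> x \<equiv> kde K (H n) n (\<lambda>j. X j \<omega>) x"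

text \<open>The expansion is taken at u = t \<open>tau n\<close>, where n times the quadratic term
  is exactly \<open>b n\<close> times t^2 kappa f(x) / 2. Uniformity in t matters because the
  Chernoff parameter depends on x.\<close>

lemma mgf_dev_asymp:
  assumes e: "0 < e"
  shows "\<forall>\<^sub>F n in sequentially. \<forall>x t. \<bar>t\<bar> \<le> T \<longrightarrow>
     exp (b n * (t\<^sup>2 * (kernel_sq K * f x) / 2 - e)) \<le> expectation (\<lambda>\<omega>. exp (t * (tau n * dev n (hs n) x \<omega>))) \<and>
     expectation (\<lambda>\<omega>. exp (t * (tau n * dev n (hs n) x \<omega>))) \<le> exp (b n * (t\<^sup>2 * (kernel_sq K * f x) / 2 + e))"
proof -
  obtain C u0 where C: "0 < u0" "0 \<le> C" and log_mgf: "\<And>u S x. \<bar>u\<bar> \<le> u0 \<Longrightarrow> 0 < S \<Longrightarrow> S \<le> 1 \<Longrightarrow>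
     \<bar>ln (expectation (\<lambda>\<omega>. exp (u * K ((x - X 1 \<omega>) / S)))) - u * S * f x - u\<^sup>2 * S * kernel_sq K * f x / 2\<bar>
     \<le> C * (\<bar>u\<bar> * S ^ 3 + u\<^sup>2 * S\<^sup>2 + \<bar>u\<bar> ^ 3 * S)"
    using log_mgf_expansion by blast
  have "(\<lambda>n. \<bar>T\<bar> * tau n) \<longlonglongrightarrow> \<bar>T\<bar> * 0" by (intro tendsto_intros tau_lim)
  then have small_u: "\<forall>\<^sub>F n in sequentially. \<bar>T\<bar> * tau n < u0"
    using C(1) by (intro order_tendstoD) auto
  have "(\<lambda>n. C * (\<bar>T\<bar> * ((hs n)\<^sup>2 / tau n) + T\<^sup>2 * hs n + \<bar>T\<bar> ^ 3 * tau n))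
      \<longlonglongrightarrow> C * (\<bar>T\<bar> * 0 + T\<^sup>2 * 0 + \<bar>T\<bar> ^ 3 * 0)"
    by (intro tendsto_intros bias_negligible hs_lim tau_lim)
  then have small_e: "\<forall>\<^sub>F n in sequentially. C * (\<bar>T\<bar> * ((hs n)\<^sup>2 / tau n) + T\<^sup>2 * hs n + \<bar>T\<bar> ^ 3 * tau n) < e"
    using e by (intro order_tendstoD) auto
  have hs1: "\<forall>\<^sub>F n in sequentially. hs n < 1"
    using hs_lim by (rule order_tendstoD) simp
  show ?thesis
    using small_u small_e hs1 ev_ge[of 2]
  proof eventually_elim
    case (elim n)
    have n: "1 \<le> n" and S: "0 < hs n" and tau: "0 < tau n"
      using elim(4) hs_pos[of n] tau_pos[of n] by auto
    show ?case
    proof (intro allI impI)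
      fix x t :: real assume t: "\<bar>t\<bar> \<le> T"
      define u where "u = t * tau n"
      define q where "q = ln (expectation (\<lambda>\<omega>. exp (u * K ((x - X 1 \<omega>) / hs n)))) - u * hs n * f x"
      have T0: "\<bar>t\<bar> \<le> \<bar>T\<bar>" using t by simp
      have u: "\<bar>u\<bar> = \<bar>t\<bar> * tau n" using tau by (simp add: u_def abs_mult)
      have "\<bar>t\<bar> * tau n \<le> \<bar>T\<bar> * tau n" using T0 tau by (intro mult_right_mono) auto
      then have "\<bar>u\<bar> \<le> u0" using elim(1) u by linarith
      then have "\<bar>q - u\<^sup>2 * hs n * kernel_sq K * f x / 2\<bar> \<le> C * (\<bar>u\<bar> * hs n ^ 3 + u\<^sup>2 * (hs n)\<^sup>2 + \<bar>u\<bar> ^ 3 * hs n)"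
        unfolding q_def using log_mgf[of u "hs n" x] S elim(3) by linarith
      \<comment> \<open>n times the prefactor is \<open>b n\<close>, so the bracket is the error
        relative to the speed: the bias against \<open>tau n\<close>, then \<open>hs n\<close> from
        the second moment and the logarithm, then \<open>tau n\<close> from the cubic
        remainder.\<close>
      also have "\<dots> = (tau n)\<^sup>2 * hs n * (C * (\<bar>t\<bar> * ((hs n)\<^sup>2 / tau n) + \<bar>t\<bar>\<^sup>2 * hs n + \<bar>t\<bar> ^ 3 * tau n))"
        unfolding u using tau
        by (simp add: u_def field_simps power2_eq_square power3_eq_cube)
      also have "\<dots> \<le> (tau n)\<^sup>2 * hs n * (C * (\<bar>T\<bar> * ((hs n)\<^sup>2 / tau n) + \<bar>T\<bar>\<^sup>2 * hs n + \<bar>T\<bar> ^ 3 * tau n))"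
        using S tau C(2) T0 by (intro mult_left_mono add_mono mult_right_mono power_mono) auto
      also have "\<dots> \<le> (tau n)\<^sup>2 * hs n * e"
        using S tau elim(2) by (intro mult_left_mono) auto
      finally have "real n * \<bar>q - u\<^sup>2 * hs n * kernel_sq K * f x / 2\<bar> \<le> n * ((tau n)\<^sup>2 * hs n * e)"
        by (intro mult_left_mono) auto
      also have "real n * \<bar>q - u\<^sup>2 * hs n * kernel_sq K * f x / 2\<bar> = \<bar>n * q - b n * (t\<^sup>2 * (kernel_sq K * f x) / 2)\<bar>"
      proof -
        have "n * (q - u\<^sup>2 * hs n * kernel_sq K * f x / 2) = n * q - b n * (t\<^sup>2 * (kernel_sq K * f x) / 2)"
          by (simp add: b_eq[OF n] u_def right_diff_distrib power_mult_distrib mult_ac)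
        then show ?thesis by (metis abs_mult abs_of_nat)
      qed
      also have "n * ((tau n)\<^sup>2 * hs n * e) = b n * e" by (simp add: b_eq[OF n])
      finally have *: "\<bar>n * q - b n * (t\<^sup>2 * (kernel_sq K * f x) / 2)\<bar> \<le> b n * e" .
      have "expectation (\<lambda>\<omega>. exp (t * (tau n * dev n (hs n) x \<omega>))) = exp (n * q)"
        using expectation_exp_dev[OF S, of u n x] by (simp add: q_def u_def mult.assoc)
      then show "exp (b n * (t\<^sup>2 * (kernel_sq K * f x) / 2 - e)) \<le> expectation (\<lambda>\<omega>. exp (t * (tau n * dev n (hs n) x \<omega>))) \<and>
     expectation (\<lambda>\<omega>. exp (t * (tau n * dev n (hs n) x \<omega>))) \<le> exp (b n * (t\<^sup>2 * (kernel_sq K * f x) / 2 + e))"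
        using * by (simp add: abs_le_iff right_diff_distrib distrib_left)
    qed
  qed
qed

text \<open>The error of the estimator in units of \<open>tau n\<close>, multiplied by the speed, is
  the variable whose exponential moments are known.\<close>

lemma est_minus_f:
  assumes "2 \<le> n"
  shows "tau n * dev n (hs n) x \<omega> = b n * ((est hs n \<omega> x - f x) / tau n)"
  using assms hs_pos[of n] tau_pos[of n] by (simp add: dev_eq_kde b_eq power2_eq_square)

text \<open>The optimal Chernoff parameter s / v gives the exponent s^2 / (2 v) = (1 - e)^2, free of
  x. The further loss e is the error of the exponential moments, and the factor 2 counts the two
  signs.\<close>

lemma upper_deviation:
  assumes d: "0 < d" and e: "0 < e" "e < 1"
  shows "\<forall>\<^sub>F n in sequentially. \<forall>x. d \<le> f x \<longrightarrow>
    prob {\<omega> \<in> space M. tau n * ((1 - e) * sqrt (2 * kernel_sq K * f x)) \<le> \<bar>est hs n \<omega> x - f x\<bar>}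
    \<le> 2 * exp (- b n * ((1 - e)\<^sup>2 - e))"
proof -
  define kp where "kp = kernel_sq K"
  have kp: "0 < kp" using kernel_sq_pos by (simp add: kp_def)
  \<comment> \<open>An upper bound for s / v over all x with f(x) at least d; this is where a
    density bounded away from zero is used.\<close>
  define T where "T = sqrt (2 / (kp * d))"
  show ?thesis
    using mgf_dev_asymp[OF e(1), of T] ev_ge[of 2]
  proof eventually_elim
    case (elim n)
    note n = elim(2)
    have tau: "0 < tau n" and b: "0 < b n" using tau_pos[OF n] b_pos[OF n] .
    show ?case
    proof (intro allI impI)
      fix x assume x: "d \<le> f x"
      then have fx: "0 < f x" using d by linarith
      define v where "v = kp * f x"
      have v: "0 < v" using kp fx by (simp add: v_def)
      define s where "s = (1 - e) * sqrt (2 * v)"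
      have s: "0 \<le> s" "s\<^sup>2 = (1 - e)\<^sup>2 * (2 * v)" using e v by (auto simp: s_def power_mult_distrib)
      define t where "t = s / v"
      have t0: "0 \<le> t" using s v by (simp add: t_def)
      have "t\<^sup>2 \<le> T\<^sup>2"
      proof -
        have "t\<^sup>2 = (1 - e)\<^sup>2 * (2 * v) / v\<^sup>2" by (simp only: t_def power_divide s(2))
        also have "\<dots> = (1 - e)\<^sup>2 * (2 / v)" using v by (simp add: power2_eq_square[of v])
        also have "\<dots> \<le> 1 * (2 / (kp * d))"
          using e kp d x by (intro mult_mono frac_le) (auto simp: v_def power_le_one)
        finally show ?thesis using kp d by (simp add: T_def)
      qed
      moreover have "0 \<le> T" using kp d by (simp add: T_def)
      ultimately have tT: "t \<le> T" by (rule power2_le_imp_le)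
      have expo: "- t * (b n * s) + b n * (t\<^sup>2 * v / 2 + e) = - b n * ((1 - e)\<^sup>2 - e)"
      proof -
        have "t * s = s\<^sup>2 / v" "t\<^sup>2 * v = s\<^sup>2 / v" using v by (simp_all add: t_def power2_eq_square)
        then have ts: "t * s = 2 * (1 - e)\<^sup>2" "t\<^sup>2 * v = 2 * (1 - e)\<^sup>2" using v unfolding s(2) by simp_all
        have "- t * (b n * s) + b n * (t\<^sup>2 * v / 2 + e) = b n * (t\<^sup>2 * v / 2 + e - t * s)"
          by (simp add: algebra_simps)
        also have "\<dots> = - b n * ((1 - e)\<^sup>2 - e)" unfolding ts by (simp add: algebra_simps)
        finally show ?thesis .
      qed
      have tail: "prob {\<omega> \<in> space M. b n * s \<le> r * (tau n * dev n (hs n) x \<omega>)} \<le> exp (- b n * ((1 - e)\<^sup>2 - e))"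
        if r: "r = 1 \<or> r = -1" for r
      proof -
        have tr: "\<bar>t * r\<bar> \<le> T" "(t * r)\<^sup>2 = t\<^sup>2" using r t0 tT by auto
        have "prob {\<omega> \<in> space M. b n * s \<le> r * (tau n * dev n (hs n) x \<omega>)}
          \<le> exp (- t * (b n * s)) * expectation (\<lambda>\<omega>. exp (t * (r * (tau n * dev n (hs n) x \<omega>))))"
          using t0 integrable_exp_dev[of "t * r * tau n" n "hs n" x]
          by (intro chernoff_bound) (auto simp: mult.assoc)
        also have "\<dots> \<le> exp (- t * (b n * s)) * exp (b n * (t\<^sup>2 * v / 2 + e))"
          using elim(1)[rule_format, OF tr(1), of x] tr(2)
          by (intro mult_left_mono) (auto simp: v_def kp_def mult.assoc)
        also have "\<dots> = exp (- b n * ((1 - e)\<^sup>2 - e))"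
          unfolding expo[symmetric] exp_add ..
        finally show ?thesis .
      qed
      have "prob {\<omega> \<in> space M. tau n * ((1 - e) * sqrt (2 * kernel_sq K * f x)) \<le> \<bar>est hs n \<omega> x - f x\<bar>}
        \<le> prob ({\<omega> \<in> space M. b n * s \<le> 1 * (tau n * dev n (hs n) x \<omega>)} \<union> {\<omega> \<in> space M. b n * s \<le> -1 * (tau n * dev n (hs n) x \<omega>)})"
      proof (rule finite_measure_mono)
        show "{\<omega> \<in> space M. tau n * ((1 - e) * sqrt (2 * kernel_sq K * f x)) \<le> \<bar>est hs n \<omega> x - f x\<bar>} \<subseteq>
          {\<omega> \<in> space M. b n * s \<le> 1 * (tau n * dev n (hs n) x \<omega>)} \<union> {\<omega> \<in> space M. b n * s \<le> -1 * (tau n * dev n (hs n) x \<omega>)}"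
        proof safe
          fix \<omega> assume w: "tau n * ((1 - e) * sqrt (2 * kernel_sq K * f x)) \<le> \<bar>est hs n \<omega> x - f x\<bar>"
            and neg: "\<not> b n * s \<le> -1 * (tau n * dev n (hs n) x \<omega>)"
          have "s \<le> \<bar>(est hs n \<omega> x - f x) / tau n\<bar>"
            using w tau by (simp add: s_def v_def kp_def pos_le_divide_eq abs_divide mult_ac)
          then have "s \<le> (est hs n \<omega> x - f x) / tau n \<or> s \<le> - ((est hs n \<omega> x - f x) / tau n)"
            by linarith
          then have "b n * s \<le> b n * ((est hs n \<omega> x - f x) / tau n) \<or> b n * s \<le> b n * (- ((est hs n \<omega> x - f x) / tau n))"
            using b by (meson mult_left_mono less_imp_le)
          then show "b n * s \<le> 1 * (tau n * dev n (hs n) x \<omega>)"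
            using neg unfolding est_minus_f[OF n] by auto
        qed
      qed measurable
      also have "\<dots> \<le> prob {\<omega> \<in> space M. b n * s \<le> 1 * (tau n * dev n (hs n) x \<omega>)}
          + prob {\<omega> \<in> space M. b n * s \<le> -1 * (tau n * dev n (hs n) x \<omega>)}"
        by (rule measure_Un_le) measurable
      also have "\<dots> \<le> 2 * exp (- b n * ((1 - e)\<^sup>2 - e))"
        using tail[of 1] tail[of "-1"] by simp
      finally show "prob {\<omega> \<in> space M. tau n * ((1 - e) * sqrt (2 * kernel_sq K * f x)) \<le> \<bar>est hs n \<omega> x - f x\<bar>}
        \<le> 2 * exp (- b n * ((1 - e)\<^sup>2 - e))" .
    qed
  qed
qed

text \<open>One side suffices for a lower bound. The tilt moves the mass to a window just above the
  target, and the cost of the shift is nearly s^2 / (2 v) = (1 + e)^2.\<close>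

lemma lower_deviation:
  assumes fx: "0 < f x" and e: "0 < e"
  shows "\<forall>\<^sub>F n in sequentially. exp (- b n * ((1 + e)\<^sup>2 + e)) \<le>
    prob {\<omega> \<in> space M. tau n * ((1 + e) * sqrt (2 * kernel_sq K * f x)) < est hs n \<omega> x - f x}"
proof -
  define v where "v = kernel_sq K * f x"
  have v: "0 < v" using kernel_sq_pos fx by (simp add: v_def)
  define s where "s = (1 + e) * sqrt (2 * v)"
  have s: "0 \<le> s" "s\<^sup>2 = (1 + e)\<^sup>2 * (2 * v)" using e v by (auto simp: s_def power_mult_distrib)
  \<comment> \<open>The expression is the cost of a window of radius g in units of the speed. At g =
    0 it equals (1 + e)^2, so a small g keeps the excess below e / 2.\<close>
  have "((\<lambda>g. ((s + g)\<^sup>2 / 2 + (s + g) * g) / v) \<longlongrightarrow> ((s + 0)\<^sup>2 / 2 + (s + 0) * 0) / v) (at_right 0)"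
    using v by (intro tendsto_intros) auto
  moreover have "((s + 0)\<^sup>2 / 2 + (s + 0) * 0) / v < (1 + e)\<^sup>2 + e / 2" using v s e by simp
  ultimately have "\<forall>\<^sub>F g in at_right 0. ((s + g)\<^sup>2 / 2 + (s + g) * g) / v < (1 + e)\<^sup>2 + e / 2"
    by (rule order_tendstoD)
  moreover have "\<forall>\<^sub>F g::real in at_right 0. 0 < g" by (rule eventually_at_right_less)
  ultimately have "\<forall>\<^sub>F g in at_right 0. 0 < g \<and> ((s + g)\<^sup>2 / 2 + (s + g) * g) / v < (1 + e)\<^sup>2 + e / 2"
    by eventually_elim simp
  then obtain g where g: "0 < g" "((s + g)\<^sup>2 / 2 + (s + g) * g) / v < (1 + e)\<^sup>2 + e / 2"
    using eventually_happens[of _ "at_right (0::real)"] by auto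
  \<comment> \<open>The window has centre \<open>b n * (s + g)\<close> and radius
    \<open>b n * g\<close>, so its lower end is the target \<open>b n * s\<close>. The shift
    \<open>y\<close> minimises y^2 v / 2 - y g, with minimum - g^2 / (2 v).\<close>
  define t where "t = (s + g) / v"
  define y where "y = g / v"
  define R where "R = t\<^sup>2 * v / 2 + t * g"
  \<comment> \<open>The second bound leaves a rate of at least g^2 / (4 v) for the mass outside the
    window. The first leaves e / 4 of the budget e, after e / 2 for \<open>R\<close> and e / 4 for
    \<open>e1\<close>, to absorb a factor 1 / 2.\<close>
  define e1 where "e1 = min (e / 4) (g\<^sup>2 / (8 * v))"
  have e1: "0 < e1" "e1 \<le> e / 4" "e1 \<le> g\<^sup>2 / (8 * v)" using e g v by (auto simp: e1_def)
  have t0: "0 \<le> t" and y0: "0 \<le> y" using s g v by (auto simp: t_def y_def)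
  have tv: "t * v - g = s" using v by (simp add: t_def)
  have R: "R < (1 + e)\<^sup>2 + e / 2"
  proof -
    have "R = ((s + g)\<^sup>2 / 2 + (s + g) * g) / v"
      using v by (simp add: R_def t_def power2_eq_square field_simps)
    then show ?thesis using g by simp
  qed
  have yg: "y\<^sup>2 * v / 2 - y * g = - (g\<^sup>2 / (2 * v))"
    using v by (simp add: y_def power2_eq_square field_simps)
  \<comment> \<open>The first threshold makes the mass outside the window at most half of the main
    term; the second pays for that half.\<close>
  have tail0: "\<forall>\<^sub>F n in sequentially. ln 4 / (g\<^sup>2 / (4 * v)) \<le> b n" "\<forall>\<^sub>F n in sequentially. ln 2 / (e / 4) \<le> b n"
    using b_lim unfolding filterlim_at_top by blast+
  show ?thesis
    using mgf_dev_asymp[OF e1(1), of "t + y"] ev_ge[of 2] tail0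
  proof eventually_elim
    case (elim n)
    note n = elim(2)
    have tau: "0 < tau n" and b: "0 < b n" using tau_pos[OF n] b_pos[OF n] .
    let ?Z = "\<lambda>\<omega>. tau n * dev n (hs n) x \<omega>"
    note mgf = elim(1)[rule_format, of _ x, folded v_def]
    have low: "exp (b n * (- t\<^sup>2 * v / 2 - t * g - e1)) - 2 * exp (b n * (- t\<^sup>2 * v / 2 - t * g + y\<^sup>2 * v / 2 - y * g + e1))
      \<le> prob {\<omega> \<in> space M. b n * (t * v - g) < ?Z \<omega>}"
    proof (rule tilting_lower_bound)
      show "integrable M (\<lambda>\<omega>. exp (t' * ?Z \<omega>))" for t'
        using integrable_exp_dev[of "t' * tau n" n "hs n" x] by (simp add: mult.assoc)
      show "exp (b n * (t\<^sup>2 * v / 2 - e1)) \<le> expectation (\<lambda>\<omega>. exp (t * ?Z \<omega>))"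
        using mgf[of t] t0 y0 by auto
      show "expectation (\<lambda>\<omega>. exp ((t + y) * ?Z \<omega>)) \<le> exp (b n * ((t + y)\<^sup>2 * v / 2 + e1))"
        using mgf[of "t + y"] t0 y0 by auto
      show "expectation (\<lambda>\<omega>. exp ((t - y) * ?Z \<omega>)) \<le> exp (b n * ((t - y)\<^sup>2 * v / 2 + e1))"
        using mgf[of "t - y"] t0 y0 by auto
    qed (use t0 y0 in auto)
    have "2 * exp (b n * (- t\<^sup>2 * v / 2 - t * g + y\<^sup>2 * v / 2 - y * g + e1))
       = 2 * exp (- (b n * (g\<^sup>2 / (2 * v) - 2 * e1))) * exp (- (b n * (R + e1)))"
    proof -
      have "b n * (- t\<^sup>2 * v / 2 - t * g + y\<^sup>2 * v / 2 - y * g + e1) = b n * (- t\<^sup>2 * v / 2 - t * g + (y\<^sup>2 * v / 2 - y * g) + e1)"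
        by simp
      also have "\<dots> = - (b n * (g\<^sup>2 / (2 * v) - 2 * e1)) + - (b n * (R + e1))"
        unfolding yg by (simp add: R_def algebra_simps)
      finally show ?thesis by (simp only: exp_add mult.assoc)
    qed
    also have "\<dots> \<le> (1 / 2) * exp (- (b n * (R + e1)))"
    proof (rule mult_right_mono)
      have "g\<^sup>2 / (4 * v) \<le> g\<^sup>2 / (2 * v) - 2 * e1" using e1(3) by (simp add: field_simps)
      then have "b n * (g\<^sup>2 / (4 * v)) \<le> b n * (g\<^sup>2 / (2 * v) - 2 * e1)" using b by (intro mult_left_mono) auto
      moreover have "0 < g\<^sup>2 / (4 * v)" using g v by simp
      then have "ln 4 \<le> b n * (g\<^sup>2 / (4 * v))" using elim(3) by (simp only: pos_divide_le_eq)
      ultimately have "exp (- (b n * (g\<^sup>2 / (2 * v) - 2 * e1))) \<le> exp (- ln 4)" by (intro exp_mono) linarith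
      also have "\<dots> = 1 / 4" by (simp add: exp_minus)
      finally show "2 * exp (- (b n * (g\<^sup>2 / (2 * v) - 2 * e1))) \<le> 1 / 2" by simp
    qed simp
    finally have sec: "2 * exp (b n * (- t\<^sup>2 * v / 2 - t * g + y\<^sup>2 * v / 2 - y * g + e1)) \<le> (1 / 2) * exp (- (b n * (R + e1)))" .
    have "exp (- b n * ((1 + e)\<^sup>2 + e)) \<le> exp (- ln 2 + - (b n * (R + e1)))"
    proof (rule exp_mono)
      have "ln 2 \<le> b n * (e / 4)" using elim(4) e by (simp add: pos_divide_le_eq)
      moreover have "b n * (R + e1) + b n * (e / 4) \<le> b n * ((1 + e)\<^sup>2 + e)"
        unfolding distrib_left[symmetric] using R e1(2) b by (intro mult_left_mono) auto
      ultimately show "- b n * ((1 + e)\<^sup>2 + e) \<le> - ln 2 + - (b n * (R + e1))" by simp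
    qed
    also have "\<dots> = 1 / 2 * exp (- (b n * (R + e1)))" by (simp only: exp_add) (simp add: exp_minus)
    also have "\<dots> \<le> exp (b n * (- t\<^sup>2 * v / 2 - t * g - e1)) - 2 * exp (b n * (- t\<^sup>2 * v / 2 - t * g + y\<^sup>2 * v / 2 - y * g + e1))"
    proof -
      have "b n * (- t\<^sup>2 * v / 2 - t * g - e1) = - (b n * (R + e1))" by (simp add: R_def algebra_simps)
      then show ?thesis using sec by simp
    qed
    also note low
    also have "{\<omega> \<in> space M. b n * (t * v - g) < ?Z \<omega>}
       = {\<omega> \<in> space M. tau n * ((1 + e) * sqrt (2 * kernel_sq K * f x)) < est hs n \<omega> x - f x}"
      unfolding est_minus_f[OF n] tv unfolding s_def v_def using b tau
      by (simp add: pos_less_divide_eq mult_ac)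
    finally show ?case .
  qed
qed

text \<open>Here the deviation is fixed, so the Chernoff parameter is a constant and the bound is
  exponential in n h. As \<open>b n\<close> is o(n h), this beats \<open>exp (- b n * r)\<close> for
  whatever r a caller asks.\<close>

lemma consistency_deviation:
  assumes eta: "0 < eta"
  shows "\<forall>\<^sub>F n in sequentially. \<forall>x. prob {\<omega> \<in> space M. eta \<le> \<bar>est h n \<omega> x - f x\<bar>} \<le> 2 * exp (- b n * r)"
proof -
  obtain C u0 where C: "0 < u0" "0 \<le> C" and log_mgf: "\<And>u S x. \<bar>u\<bar> \<le> u0 \<Longrightarrow> 0 < S \<Longrightarrow> S \<le> 1 \<Longrightarrow>
     \<bar>ln (expectation (\<lambda>\<omega>. exp (u * K ((x - X 1 \<omega>) / S)))) - u * S * f x - u\<^sup>2 * S * kernel_sq K * f x / 2\<bar>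
     \<le> C * (\<bar>u\<bar> * S ^ 3 + u\<^sup>2 * S\<^sup>2 + \<bar>u\<bar> ^ 3 * S)"
    using log_mgf_expansion by blast
  define kp where "kp = kernel_sq K"
  have kp: "0 < kp" using kernel_sq_pos by (simp add: kp_def)
  define D where "D = kp * B / 2 + 2 * C + 1"
  have D: "1 \<le> D" using kp B_pos C by (simp add: D_def)
  \<comment> \<open>u D is at most eta / 4. Together with a bias below eta / 4 the centred
    log-moment per observation is at most half of u h eta, and the other half is the gain.\<close>
  define u where "u = min u0 (min 1 (eta / (4 * D)))"
  have u: "0 < u" "u \<le> u0" "u \<le> 1" "u \<le> eta / (4 * D)" using C eta D by (auto simp: u_def)
  have uD: "u * D \<le> eta / 4" using u(4) D by (simp add: field_simps)
  have "(\<lambda>n. C * (h n)\<^sup>2) \<longlonglongrightarrow> C * 0\<^sup>2" by (intro tendsto_intros h_lim)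
  then have small1: "\<forall>\<^sub>F n in sequentially. C * (h n)\<^sup>2 < eta / 4"
    using eta by (intro order_tendstoD) auto
  have small2: "\<forall>\<^sub>F n in sequentially. h n < 1" using h_lim by (rule order_tendstoD) simp
  have "(\<lambda>n. r * (b n / (n * h n))) \<longlonglongrightarrow> r * 0" by (intro tendsto_intros b_over_nh)
  then have small3: "\<forall>\<^sub>F n in sequentially. r * (b n / (n * h n)) < u * eta / 2"
    using eta u by (intro order_tendstoD) auto
  show ?thesis
    using small1 small2 small3 ev_ge[of 1]
  proof eventually_elim
    case (elim n)
    note n = elim(4)
    have H: "0 < h n" using h_pos[OF n] .
    have nH: "0 < n * h n" using H n by simp
    show ?case
    proof
      fix x
      have tail: "prob {\<omega> \<in> space M. n * h n * eta \<le> s * dev n (h n) x \<omega>} \<le> exp (- b n * r)"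
        if s: "s = 1 \<or> s = -1" for s
      proof -
        have us: "\<bar>u * s\<bar> = u" "(u * s)\<^sup>2 = u\<^sup>2" using s u by auto
        define q where "q = ln (expectation (\<lambda>\<omega>. exp ((u * s) * K ((x - X 1 \<omega>) / h n)))) - (u * s) * h n * f x"
        have "q \<le> u\<^sup>2 * h n * kp * f x / 2 + C * (u * h n ^ 3 + u\<^sup>2 * (h n)\<^sup>2 + u ^ 3 * h n)"
          using log_mgf[of "u * s" "h n" x] u elim(2) H unfolding us q_def kp_def by linarith
        also have "u\<^sup>2 * h n * kp * f x / 2 \<le> u * h n * (u * (kp * B / 2))"
          using mult_left_mono[OF f_le[of x], of "u\<^sup>2 * h n * kp"] u H kp by (simp add: power2_eq_square mult_ac)
        also have "C * (u * h n ^ 3 + u\<^sup>2 * (h n)\<^sup>2 + u ^ 3 * h n) = u * h n * (C * (h n)\<^sup>2 + C * (u * h n + u\<^sup>2))"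
          by (simp add: power2_eq_square power3_eq_cube algebra_simps)
        also have "\<dots> \<le> u * h n * (eta / 4 + C * (u * 2))"
        proof -
          have "u * h n \<le> u * 1" using u elim(2) by (intro mult_left_mono) auto
          moreover have "u\<^sup>2 \<le> u" using u power_decreasing[of 1 2 u] by simp
          ultimately have "C * (u * h n + u\<^sup>2) \<le> C * (u * 2)" using C(2) by (intro mult_left_mono) auto
          then show ?thesis using u H elim(1) by (intro mult_left_mono) auto
        qed
        also have "u * h n * (u * (kp * B / 2)) + u * h n * (eta / 4 + C * (u * 2)) = u * h n * (eta / 4 + u * (D - 1))"
          by (simp add: D_def algebra_simps)
        also have "\<dots> \<le> u * h n * (eta / 4 + u * D)" using u H by (intro mult_left_mono) auto
        also have "\<dots> \<le> u * h n * (eta / 2)" using uD u H by (intro mult_left_mono) auto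
        finally have "q \<le> u * h n * (eta / 2)" by simp
        then have q: "n * q \<le> n * (u * h n * (eta / 2))" by (intro mult_left_mono) auto
        have "prob {\<omega> \<in> space M. n * h n * eta \<le> s * dev n (h n) x \<omega>}
          \<le> exp (- u * (n * h n * eta)) * expectation (\<lambda>\<omega>. exp (u * (s * dev n (h n) x \<omega>)))"
          using u integrable_exp_dev[of "u * s" n "h n" x]
          by (intro chernoff_bound) (auto simp: mult.assoc)
        also have "expectation (\<lambda>\<omega>. exp (u * (s * dev n (h n) x \<omega>))) = exp (n * q)"
          using expectation_exp_dev[OF H, of "u * s" n x] by (simp add: q_def mult.assoc)
        also have "exp (- u * (n * h n * eta)) * exp (n * q) = exp (- u * (n * h n * eta) + n * q)"
          by (simp only: exp_add)
        also have "\<dots> \<le> exp (- b n * r)"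
        proof (rule exp_mono)
          have "b n * r \<le> n * h n * (u * eta / 2)" using elim(3) nH by (simp add: pos_divide_less_eq mult_ac)
          then show "- u * (n * h n * eta) + n * q \<le> - b n * r" using q by (simp add: algebra_simps)
        qed
        finally show ?thesis .
      qed
      have "prob {\<omega> \<in> space M. eta \<le> \<bar>est h n \<omega> x - f x\<bar>}
        \<le> prob ({\<omega> \<in> space M. n * h n * eta \<le> 1 * dev n (h n) x \<omega>} \<union> {\<omega> \<in> space M. n * h n * eta \<le> -1 * dev n (h n) x \<omega>})"
      proof (rule finite_measure_mono)
        show "{\<omega> \<in> space M. eta \<le> \<bar>est h n \<omega> x - f x\<bar>} \<subseteq>
          {\<omega> \<in> space M. n * h n * eta \<le> 1 * dev n (h n) x \<omega>} \<union> {\<omega> \<in> space M. n * h n * eta \<le> -1 * dev n (h n) x \<omega>}"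
        proof safe
          fix \<omega> assume w: "eta \<le> \<bar>est h n \<omega> x - f x\<bar>"
            and neg: "\<not> n * h n * eta \<le> -1 * dev n (h n) x \<omega>"
          have "eta \<le> est h n \<omega> x - f x \<or> eta \<le> - (est h n \<omega> x - f x)" using w by linarith
          then have "n * h n * eta \<le> n * h n * (est h n \<omega> x - f x) \<or> n * h n * eta \<le> n * h n * (- (est h n \<omega> x - f x))"
            using nH by (meson mult_left_mono less_imp_le)
          then show "n * h n * eta \<le> 1 * dev n (h n) x \<omega>"
            using neg unfolding dev_eq_kde[OF n H] by (simp only: mult_1 mult_minus1 mult_minus_right) blast
        qed
      qed measurable
      also have "\<dots> \<le> prob {\<omega> \<in> space M. n * h n * eta \<le> 1 * dev n (h n) x \<omega>}
          + prob {\<omega> \<in> space M. n * h n * eta \<le> -1 * dev n (h n) x \<omega>}"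
        by (rule measure_Un_le) measurable
      also have "\<dots> \<le> 2 * exp (- b n * r)"
        using tail[of 1] tail[of "-1"] by simp
      finally show "prob {\<omega> \<in> space M. eta \<le> \<bar>est h n \<omega> x - f x\<bar>} \<le> 2 * exp (- b n * r)" .
    qed
  qed
qed

section \<open>The confidence band\<close>

lemma h_ge_inverse: "1 \<le> n \<Longrightarrow> 1 / n \<le> h n"
  using a powr_mono[of "-1" "- a" "real n"] by (simp add: h_def powr_minus_divide)

text \<open>The grid depends on n only, and its error bound holds for every sample \<open>Y\<close>
  and every bandwidth from \<open>h n\<close> upwards, so it covers both estimators on every
  outcome. The error n^(-2) is o(\<open>tau n\<close>).\<close>

lemma fine_grid:
  assumes c: "c1 < c2" and b: "0 < \<beta>"
    and hoelder: "\<And>x y. \<bar>K x - K y\<bar> \<le> L * \<bar>x - y\<bar> powr \<beta>"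
  shows "\<exists>p C. \<forall>n::nat\<ge>1. \<exists>G. finite G \<and> G \<subseteq> {c1..c2} \<and> card G \<le> n ^ p + 1 \<and>
    (\<forall>x\<in>{c1..c2}. \<exists>g\<in>G. \<bar>f x - f g\<bar> \<le> C / (real n)\<^sup>2 \<and>
      (\<forall>Y. \<forall>S\<ge>h n. \<bar>kde K S n Y x - kde K S n Y g\<bar> \<le> C / (real n)\<^sup>2))"
proof -
  define w where "w = c2 - c1"
  have w: "0 < w" using c by (simp add: w_def)
  have L: "0 \<le> L" using hoelder[of 0 1] by simp
  \<comment> \<open>As 1 / S is at most n, the kernel increment is of order n powr ((1 - p) \<beta>
    + 1), and p at least 1 + 3 / \<beta> brings this to n^(-2). The Lipschitz bound on f asks for p
    at least 2.\<close>
  define p where "p = max 2 (nat \<lceil>1 + 3 / \<beta>\<rceil>)"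
  have p: "2 \<le> p" "1 + 3 / \<beta> \<le> p" unfolding p_def by linarith+
  have pb: "(1 - real p) * \<beta> \<le> -3" using p(2) b by (simp add: field_simps)
  define C where "C = max (B * w) (L * w powr \<beta>)"
  show ?thesis
  proof (rule exI[of _ p], rule exI[of _ C], intro allI impI)
    fix n :: nat assume n: "1 \<le> n"
    define G where "G = (\<lambda>i. c1 + w * real i / real (n ^ p)) ` {0..n ^ p}"
    have np: "0 < n ^ p" using n by simp
    have Gsub: "G \<subseteq> {c1..c2}"
    proof
      fix g assume "g \<in> G"
      then obtain i where i: "i \<le> n ^ p" "g = c1 + w * (real i / real (n ^ p))" by (auto simp: G_def)
      have "real i / real (n ^ p) \<le> 1" using i(1) np by (simp only: divide_le_eq_1_pos of_nat_0_less_iff of_nat_le_iff)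
      then have "w * (real i / real (n ^ p)) \<le> w * 1" using w by (intro mult_left_mono) auto
      then show "g \<in> {c1..c2}" using i w by (auto simp: w_def)
    qed
    have Gcard: "card G \<le> n ^ p + 1"
      unfolding G_def by (rule order_trans[OF card_image_le]) auto
    have near: "\<exists>g\<in>G. \<bar>f x - f g\<bar> \<le> C / (real n)\<^sup>2 \<and>
      (\<forall>Y. \<forall>S\<ge>h n. \<bar>kde K S n Y x - kde K S n Y g\<bar> \<le> C / (real n)\<^sup>2)" if x: "x \<in> {c1..c2}" for x
    proof -
      obtain g where g: "g \<in> G" "\<bar>x - g\<bar> \<le> w / real (n ^ p)"
        using exists_grid_point[OF x c np] unfolding G_def w_def by blast
      have "\<bar>f x - f g\<bar> \<le> B * \<bar>x - g\<bar>" by (rule f_lipschitz)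
      also have "\<dots> \<le> B * (w / real (n ^ 2))"
      proof -
        have "n ^ 2 \<le> n ^ p" using n p(1) by (intro power_increasing) auto
        then have "w / real (n ^ p) \<le> w / real (n ^ 2)"
          using w n by (intro divide_left_mono) (auto simp only: of_nat_le_iff of_nat_0_less_iff zero_less_power mult_pos_pos intro!: mult_pos_pos)
        then show ?thesis using g(2) B_nonneg by (intro mult_left_mono) auto
      qed
      also have "\<dots> \<le> C / (real n)\<^sup>2" by (simp add: C_def divide_right_mono)
      finally have fd: "\<bar>f x - f g\<bar> \<le> C / (real n)\<^sup>2" .
      have "\<bar>kde K S n Y x - kde K S n Y g\<bar> \<le> C / (real n)\<^sup>2" if S: "h n \<le> S" for S Y
      proof -
        have S0: "0 < S" using S h_pos[OF n] by linarith
        have "1 / n \<le> S" using S h_ge_inverse[OF n] by linarith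
        then have iS: "1 / S \<le> n" using S0 n by (simp add: field_simps)
        have "\<bar>x - g\<bar> / S \<le> w / real (n ^ p) * n"
          using mult_mono[OF g(2) iS] w S0 by simp
        also have "\<dots> = w * real n powr (1 - real p)"
          using n by (simp add: powr_diff powr_realpow)
        finally have "(\<bar>x - g\<bar> / S) powr \<beta> \<le> (w * real n powr (1 - real p)) powr \<beta>"
          using S0 b by (intro powr_mono2) auto
        also have "\<dots> = w powr \<beta> * real n powr ((1 - real p) * \<beta>)"
          using w n by (simp add: powr_mult powr_powr)
        also have "\<dots> \<le> w powr \<beta> * real n powr (-3)"
          using pb n by (intro mult_left_mono powr_mono) auto
        also have "real n powr (-3) = 1 / real n ^ 3"
          using n by (simp add: powr_minus_divide powr_numeral)
        finally have pw: "(\<bar>x - g\<bar> / S) powr \<beta> \<le> w powr \<beta> * (1 / real n ^ 3)" .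
        have "\<bar>kde K S n Y x - kde K S n Y g\<bar> \<le> L * (\<bar>x - g\<bar> / S) powr \<beta> / S"
          by (rule kde_hoelder[OF hoelder n S0])
        also have "\<dots> = L * (\<bar>x - g\<bar> / S) powr \<beta> * (1 / S)" by simp
        also have "\<dots> \<le> L * (w powr \<beta> * (1 / real n ^ 3)) * n"
          using pw iS L S0 by (intro mult_mono) auto
        also have "\<dots> = L * w powr \<beta> / (real n)\<^sup>2"
          using n by (simp add: power2_eq_square power3_eq_cube)
        also have "\<dots> \<le> C / (real n)\<^sup>2" by (intro divide_right_mono) (auto simp: C_def)
        finally show ?thesis .
      qed
      then show ?thesis using g(1) fd by blast
    qed
    show "\<exists>G. finite G \<and> G \<subseteq> {c1..c2} \<and> card G \<le> n ^ p + 1 \<and>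
      (\<forall>x\<in>{c1..c2}. \<exists>g\<in>G. \<bar>f x - f g\<bar> \<le> C / (real n)\<^sup>2 \<and>
        (\<forall>Y. \<forall>S\<ge>h n. \<bar>kde K S n Y x - kde K S n Y g\<bar> \<le> C / (real n)\<^sup>2))"
      using near Gsub Gcard by (intro exI[of _ G]) (auto simp: G_def)
  qed
qed

section \<open>The event that the interval misses f(x)\<close>

lemma est_borel [measurable]: "(\<lambda>\<omega>. kde K S n (\<lambda>j. X j \<omega>) x) \<in> borel_measurable M"
proof -
  have "(\<lambda>\<omega>. K ((x - X j \<omega>) / S)) \<in> borel_measurable M" if "j \<in> {1..n}" for j
  proof -
    have [measurable]: "X j \<in> borel_measurable M" using that by simp
    show ?thesis by measurable
  qed
  then have "(\<lambda>\<omega>. \<Sum>j=1..n. K ((x - X j \<omega>) / S)) \<in> borel_measurable M" by (rule borel_measurable_sum)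
  then show ?thesis unfolding kde_def by measurable
qed

text \<open>\<open>lam n\<close> stands for the half-width factor divided by sqrt (log (1/h)). The
  probability estimates use of it only the limit sqrt 2.\<close>

definition miss :: "(nat \<Rightarrow> real) \<Rightarrow> nat \<Rightarrow> 'a \<Rightarrow> real \<Rightarrow> bool" where
  "miss lam n \<omega> x \<longleftrightarrow> tau n * (sqrt (est h n \<omega> x * kernel_sq K) * lam n) < \<bar>est hs n \<omega> x - f x\<bar>"

lemma miss_set [measurable]: "{\<omega> \<in> space M. miss lam n \<omega> x} \<in> sets M"
  unfolding miss_def by measurable

text \<open>The union over x is uncountable. Missing is a strict inequality between continuous
  functions of x, hence an open condition, and the rationals suffice.\<close>

lemma uniform_miss_set:
  assumes c: "c1 < c2" and K: "continuous_on UNIV K"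
  shows "{\<omega> \<in> space M. \<exists>x\<in>{c1..c2}. miss lam n \<omega> x} \<in> sets M"
proof -
  \<comment> \<open>For S = 0 the quotient is 0 and the function is constant.\<close>
  have Kc: "continuous_on UNIV (\<lambda>x. K ((x - y) / S))" for y S
    by (rule continuous_on_compose2[OF K]) (cases "S = 0", auto intro!: continuous_intros)
  have kc: "continuous_on UNIV (\<lambda>x. kde K S n Y x)" for S Y
    unfolding kde_def by (intro continuous_intros Kc)
  have "\<exists>q\<in>\<rat> \<inter> {c1..c2}. miss lam n \<omega> q" if x: "x \<in> {c1..c2}" "miss lam n \<omega> x" for x \<omega>
  proof -
    define U where "U = {y. miss lam n \<omega> y}"
    have "open U" unfolding U_def miss_def
      by (intro open_Collect_less continuous_intros kc f_continuous)
    moreover have "x \<in> U" using x by (simp add: U_def)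
    \<comment> \<open>The point x may be an irrational endpoint, so the open set is first met with
      the open interval.\<close>
    moreover have "x \<in> closure {c1<..<c2}" using x c by simp
    ultimately have "U \<inter> {c1<..<c2} \<noteq> {}" using open_Int_closure_eq_empty[of U "{c1<..<c2}"] by blast
    then have "\<exists>q\<in>\<rat>. q \<in> U \<inter> {c1<..<c2}"
      using open_Int_closure_eq_empty[of "U \<inter> {c1<..<c2}" \<rat>] \<open>open U\<close>
      by (auto simp: Rats_closure_real open_Int)
    then show ?thesis by (auto simp: U_def)
  qed
  then have "{\<omega> \<in> space M. \<exists>x\<in>{c1..c2}. miss lam n \<omega> x}
    = (\<Union>q\<in>\<rat> \<inter> {c1..c2}. {\<omega> \<in> space M. miss lam n \<omega> q})" by blast
  also have "\<dots> \<in> sets M"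
    by (intro sets.countable_UN'' countable_Int1 countable_rat miss_set)
  finally show ?thesis .
qed

text \<open>A miss at x forces, at a nearby grid point g, either inconsistency of the width
  estimator (\<open>D g\<close>) or a deviation of the centre by nearly the full half-width
  (\<open>A g\<close>). The union bound then runs over the grid.\<close>

lemma uniform_upper:
  assumes c: "c1 < c2" and b: "0 < \<beta>"
    and hoelder: "\<And>x y. \<bar>K x - K y\<bar> \<le> L * \<bar>x - y\<bar> powr \<beta>"
    and d: "0 < d" "\<And>x. x \<in> {c1..c2} \<Longrightarrow> d \<le> f x"
    and lam: "lam \<longlonglongrightarrow> sqrt 2" and e: "0 < e" "e < 1"
  shows "\<forall>\<^sub>F n in sequentially. prob {\<omega> \<in> space M. \<exists>x\<in>{c1..c2}. miss lam n \<omega> x} \<le> exp (- b n * (1 - 5 * e))"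
proof -
  obtain p C where grid: "\<And>n. 1 \<le> n \<Longrightarrow> \<exists>G. finite G \<and> G \<subseteq> {c1..c2} \<and> card G \<le> n ^ p + 1 \<and>
    (\<forall>x\<in>{c1..c2}. \<exists>g\<in>G. \<bar>f x - f g\<bar> \<le> C / (real n)\<^sup>2 \<and>
      (\<forall>Y. \<forall>S\<ge>h n. \<bar>kde K S n Y x - kde K S n Y g\<bar> \<le> C / (real n)\<^sup>2))"
    using fine_grid[OF c b hoelder] by blast
  define kp where "kp = kernel_sq K"
  have kp: "0 < kp" using kernel_sq_pos by (simp add: kp_def)
  have "(\<lambda>n. C / (real n)\<^sup>2) \<longlonglongrightarrow> 0" by real_asymp
  then have ev1: "\<forall>\<^sub>F n in sequentially. C / (real n)\<^sup>2 < d * e / 2"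
    using d e by (intro order_tendstoD) auto
  \<comment> \<open>Outside \<open>D g\<close> the width shrinks by the factor sqrt (1 - e) only,
    while \<open>A g\<close> is defined with 1 - e. This slack, times its smallest scale sqrt (d
    kappa), absorbs the grid error of the centre and of f.\<close>
  have lim2: "(\<lambda>n. sqrt (d * kp) * (sqrt (1 - e) * lam n - (1 - e) * sqrt 2) - 2 * (C / (real n)\<^sup>2 / tau n))
      \<longlonglongrightarrow> sqrt (d * kp) * (sqrt (1 - e) * sqrt 2 - (1 - e) * sqrt 2) - 2 * 0"
    by (intro tendsto_intros lam inverse_square_over_tau)
  have "1 - e < sqrt (1 - e)"
  proof (rule real_less_rsqrt)
    show "(1 - e)\<^sup>2 < 1 - e" using e by (simp add: power2_eq_square)
  qed
  then have pos2: "0 < sqrt (d * kp) * (sqrt (1 - e) * sqrt 2 - (1 - e) * sqrt 2) - 2 * 0"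
    using d kp by simp
  have ev2: "\<forall>\<^sub>F n in sequentially. 0 < sqrt (d * kp) * (sqrt (1 - e) * lam n - (1 - e) * sqrt 2) - 2 * (C / (real n)\<^sup>2 / tau n)"
    using order_tendstoD(1)[OF lim2 pos2] .
  have ib: "(\<lambda>n. inverse (b n)) \<longlonglongrightarrow> 0"
    by (rule filterlim_compose[OF tendsto_inverse_0 filterlim_mono[OF b_lim at_top_le_at_infinity order_refl]])
  \<comment> \<open>The number 8 is 2 from the cardinality of the grid times 4 from the two events,
    each with constant 2.\<close>
  have "(\<lambda>n. ln 8 * inverse (b n) + p * (ln n / b n)) \<longlonglongrightarrow> ln 8 * 0 + real p * 0"
    by (intro tendsto_intros ib ln_over_b)
  then have ev3: "\<forall>\<^sub>F n in sequentially. ln 8 * inverse (b n) + p * (ln n / b n) < e"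
    using e by (intro order_tendstoD) auto
  have lam0: "\<forall>\<^sub>F n in sequentially. 0 < lam n" using lam by (rule order_tendstoD) simp
  have de: "0 < d * e / 2" using d e by simp
  show ?thesis
    using upper_deviation[OF d(1) e] consistency_deviation[OF de, of 1] ev1 ev2 ev3 lam0 hs_ge ev_ge[of 2]
  proof eventually_elim
    case (elim n)
    have n: "1 \<le> n" "2 \<le> n" using elim(8) by auto
    have tau: "0 < tau n" and bp: "0 < b n" using tau_pos[OF n(2)] b_pos[OF n(2)] .
    define \<rho> where "\<rho> = C / (real n)\<^sup>2"
    define A where "A g = {\<omega> \<in> space M. tau n * ((1 - e) * sqrt (2 * kernel_sq K * f g)) \<le> \<bar>est hs n \<omega> g - f g\<bar>}" for g
    define D where "D g = {\<omega> \<in> space M. d * e / 2 \<le> \<bar>est h n \<omega> g - f g\<bar>}" for g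
    obtain G where G: "finite G" "G \<subseteq> {c1..c2}" "card G \<le> n ^ p + 1"
      and near: "\<And>x. x \<in> {c1..c2} \<Longrightarrow> \<exists>g\<in>G. \<bar>f x - f g\<bar> \<le> \<rho> \<and>
        (\<forall>Y. \<forall>S\<ge>h n. \<bar>kde K S n Y x - kde K S n Y g\<bar> \<le> \<rho>)"
      using grid[OF n(1)] unfolding \<rho>_def by metis
    have meas: "A g \<in> sets M" "D g \<in> sets M" for g unfolding A_def D_def by measurable
    have sub: "{\<omega> \<in> space M. \<exists>x\<in>{c1..c2}. miss lam n \<omega> x} \<subseteq> (\<Union>g\<in>G. A g \<union> D g)"
    proof safe
      fix \<omega> x assume w: "\<omega> \<in> space M" and x: "x \<in> {c1..c2}" and m: "miss lam n \<omega> x"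
      obtain g where g: "g \<in> G" "\<bar>f x - f g\<bar> \<le> \<rho>"
        and kd: "\<And>Y S. h n \<le> S \<Longrightarrow> \<bar>kde K S n Y x - kde K S n Y g\<bar> \<le> \<rho>"
        using near[OF x] by blast
      have fg: "d \<le> f g" using g G d by auto
      have "\<omega> \<in> A g" if "\<omega> \<notin> D g"
      proof -
        have 1: "\<bar>est h n \<omega> g - f g\<bar> < d * e / 2" using that w by (auto simp: D_def)
        have 2: "\<bar>est h n \<omega> x - est h n \<omega> g\<bar> \<le> \<rho>" by (rule kd) simp
        have 3: "\<bar>est hs n \<omega> x - est hs n \<omega> g\<bar> \<le> \<rho>" by (rule kd) (rule elim(7))
        have "d * e \<le> f g * e" using fg e by (intro mult_right_mono) auto
        moreover have "f g - d * e / 2 < est h n \<omega> g" using abs_less_iff[THEN iffD1, OF 1] by linarith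
        moreover have "est h n \<omega> g - \<rho> \<le> est h n \<omega> x" using 2 by (simp add: abs_le_iff)
        ultimately have "f g - f g * e \<le> est h n \<omega> x" using elim(3)[folded \<rho>_def] by linarith
        then have "(1 - e) * f g \<le> est h n \<omega> x" by (simp add: left_diff_distrib mult.commute[of e])
        then have "sqrt (((1 - e) * f g) * kp) \<le> sqrt (est h n \<omega> x * kp)"
          using kp by (intro real_sqrt_le_mono mult_right_mono) auto
        then have "tau n * (sqrt (((1 - e) * f g) * kp) * lam n) \<le> tau n * (sqrt (est h n \<omega> x * kp) * lam n)"
          using tau elim(6) by (intro mult_left_mono mult_right_mono) auto
        also have "\<dots> < \<bar>est hs n \<omega> x - f x\<bar>" using m by (simp add: miss_def kp_def)
        also have "\<dots> \<le> \<bar>est hs n \<omega> g - f g\<bar> + 2 * \<rho>" using 3 g(2) by linarith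
        finally have 4: "tau n * (sqrt (((1 - e) * f g) * kp) * lam n) - 2 * \<rho> < \<bar>est hs n \<omega> g - f g\<bar>" by linarith
        \<comment> \<open>The sign of the bracket must be known before d can be replaced by the
          larger f(g). The product exceeds the grid error, which is nonnegative.\<close>
        have pos: "0 \<le> sqrt (1 - e) * lam n - (1 - e) * sqrt 2 \<or> C / (real n)\<^sup>2 / tau n < 0"
          using elim(4) d kp zero_less_mult_pos[of "sqrt (d * kp)" "sqrt (1 - e) * lam n - (1 - e) * sqrt 2"]
          by (cases "C / (real n)\<^sup>2 / tau n < 0") (auto simp: not_less)
        have "0 \<le> \<rho>" using g(2) by linarith
        then have "\<not> C / (real n)\<^sup>2 / tau n < 0" using tau unfolding \<rho>_def[symmetric] by (simp add: not_less)
        then have pos': "0 \<le> sqrt (1 - e) * lam n - (1 - e) * sqrt 2" using pos by blast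
        have "2 * (\<rho> / tau n) \<le> sqrt (d * kp) * (sqrt (1 - e) * lam n - (1 - e) * sqrt 2)"
          using elim(4) unfolding \<rho>_def by linarith
        also have "\<dots> \<le> sqrt (f g * kp) * (sqrt (1 - e) * lam n - (1 - e) * sqrt 2)"
          using fg kp pos' by (intro mult_right_mono real_sqrt_le_mono) auto
        finally have "tau n * (2 * (\<rho> / tau n)) \<le> tau n * (sqrt (f g * kp) * (sqrt (1 - e) * lam n - (1 - e) * sqrt 2))"
          using tau by (intro mult_left_mono) auto
        then have 5: "2 * \<rho> \<le> tau n * (sqrt (f g * kp) * (sqrt (1 - e) * lam n)) - tau n * (sqrt (f g * kp) * ((1 - e) * sqrt 2))"
          using tau by (simp add: right_diff_distrib)
        have 6: "sqrt (((1 - e) * f g) * kp) * lam n = sqrt (f g * kp) * (sqrt (1 - e) * lam n)"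
          by (simp add: real_sqrt_mult mult_ac)
        have 7: "(1 - e) * sqrt (2 * kp * f g) = sqrt (f g * kp) * ((1 - e) * sqrt 2)"
          by (simp add: real_sqrt_mult mult_ac)
        have "tau n * ((1 - e) * sqrt (2 * kp * f g)) \<le> \<bar>est hs n \<omega> g - f g\<bar>"
          using 4 5 unfolding 6 7 by linarith
        then show ?thesis using w by (simp add: A_def kp_def)
      qed
      then show "\<omega> \<in> (\<Union>g\<in>G. A g \<union> D g)" using g(1) by blast
    qed
    \<comment> \<open>As r is at most 1, rate 1 is enough for the events \<open>D g\<close>.\<close>
    define r where "r = (1 - e)\<^sup>2 - e"
    have r1: "r \<le> 1" "1 - 3 * e \<le> r" using e by (auto simp: r_def power2_eq_square algebra_simps mult_left_le)
    have AD: "prob (A g \<union> D g) \<le> 4 * exp (- b n * r)" if "g \<in> G" for g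
    proof -
      have "prob (A g \<union> D g) \<le> prob (A g) + prob (D g)" by (rule measure_Un_le[OF meas])
      also have "prob (A g) \<le> 2 * exp (- b n * r)"
        using elim(1) d(2)[of g] that G(2) unfolding A_def r_def by blast
      also have "prob (D g) \<le> 2 * exp (- b n * 1)" using elim(2) unfolding D_def by blast
      also have "exp (- b n * 1) \<le> exp (- b n * r)" using r1 bp by simp
      finally show ?thesis by simp
    qed
    have "prob {\<omega> \<in> space M. \<exists>x\<in>{c1..c2}. miss lam n \<omega> x} \<le> prob (\<Union>g\<in>G. A g \<union> D g)"
      using sub G(1) meas by (intro finite_measure_mono) auto
    also have "\<dots> \<le> (\<Sum>g\<in>G. prob (A g \<union> D g))"
      using G(1) meas by (intro measure_UNION_le) auto
    also have "\<dots> \<le> (\<Sum>g\<in>G. 4 * exp (- b n * r))" by (intro sum_mono AD)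
    also have "\<dots> = real (card G) * (4 * exp (- b n * r))" by simp
    also have "\<dots> \<le> (2 * real n ^ p) * (4 * exp (- b n * r))"
    proof (rule mult_right_mono)
      have "1 \<le> n ^ p" using n by simp
      then have "card G \<le> 2 * n ^ p" using G(3) by linarith
      then show "real (card G) \<le> 2 * real n ^ p" using of_nat_mono[of "card G" "2 * n ^ p"] by simp
    qed simp
    also have "\<dots> = (8 * real n ^ p) * exp (- b n * r)" by simp
    also have "\<dots> \<le> exp (b n * e) * exp (- b n * r)"
    proof (rule mult_right_mono)
      have "8 * real n ^ p = exp (ln 8 + p * ln n)" using n by (simp add: exp_add exp_of_nat_mult)
      also have "ln 8 + p * ln n \<le> b n * e"
      proof -
        have "b n * (ln 8 * inverse (b n) + p * (ln n / b n)) \<le> b n * e"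
          using elim(5) bp by (intro mult_left_mono) auto
        then show ?thesis using bp by (simp add: distrib_left inverse_eq_divide)
      qed
      finally show "8 * real n ^ p \<le> exp (b n * e)" by simp
    qed simp
    also have "\<dots> = exp (b n * e + - b n * r)" by (simp only: exp_add)
    also have "\<dots> \<le> exp (- b n * (1 - 5 * e))"
    proof (rule exp_mono)
      have "b n * (e - r) \<le> b n * (- (1 - 5 * e))" using r1 e bp by (intro mult_left_mono) auto
      then show "b n * e + - b n * r \<le> - b n * (1 - 5 * e)" by (simp add: algebra_simps)
    qed
    finally show ?case .
  qed
qed

text \<open>A large deviation of the centre is a miss unless the width is inflated. Consistency
  gives one factor sqrt (1 + e) and the convergence of \<open>lam\<close> another; their product is
  the 1 + e of \<open>lower_deviation\<close>.\<close>

lemma pointwise_lower: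
  assumes fx: "0 < f x" and lam: "lam \<longlonglongrightarrow> sqrt 2" and e: "0 < e" "e < 1"
  shows "\<forall>\<^sub>F n in sequentially. exp (- b n * (1 + 5 * e)) \<le> prob {\<omega> \<in> space M. miss lam n \<omega> x}"
proof -
  define kp where "kp = kernel_sq K"
  have kp: "0 < kp" using kernel_sq_pos by (simp add: kp_def)
  \<comment> \<open>Consistency is invoked at rate r + 1, so that inconsistency is smaller by
    \<open>2 * exp (- b n)\<close> than the main term \<open>exp (- b n * r)\<close>.\<close>
  define r where "r = (1 + e)\<^sup>2 + e"
  have fe: "0 < f x * e" using fx e by simp
  have "1 < sqrt (1 + e)" using e by simp
  then have "sqrt 2 < sqrt 2 * sqrt (1 + e)" by simp
  then have ev1: "\<forall>\<^sub>F n in sequentially. lam n < sqrt 2 * sqrt (1 + e)"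
    using lam by (intro order_tendstoD)
  have lam0: "\<forall>\<^sub>F n in sequentially. 0 < lam n" using lam by (rule order_tendstoD) simp
  \<comment> \<open>The threshold ln 4 makes \<open>2 * exp (- b n)\<close> at most 1 / 2; the
    threshold ln 2 / e pays for the lost factor 1 / 2.\<close>
  have ev2: "\<forall>\<^sub>F n in sequentially. max (ln 4) (ln 2 / e) \<le> b n"
    using b_lim unfolding filterlim_at_top by blast
  show ?thesis
    using lower_deviation[OF fx e(1)] consistency_deviation[OF fe, of "r + 1"] ev1 lam0 ev2 ev_ge[of 2]
  proof eventually_elim
    case (elim n)
    note n = elim(6)
    have tau: "0 < tau n" and bp: "0 < b n" using tau_pos[OF n] b_pos[OF n] .
    define A where "A = {\<omega> \<in> space M. tau n * ((1 + e) * sqrt (2 * kernel_sq K * f x)) < est hs n \<omega> x - f x}"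
    define D where "D = {\<omega> \<in> space M. f x * e \<le> \<bar>est h n \<omega> x - f x\<bar>}"
    have meas: "A \<in> sets M" "D \<in> sets M" unfolding A_def D_def by measurable
    have sub: "A - D \<subseteq> {\<omega> \<in> space M. miss lam n \<omega> x}"
    proof safe
      fix \<omega> assume A: "\<omega> \<in> A" and nD: "\<omega> \<notin> D"
      show w: "\<omega> \<in> space M" using A by (simp add: A_def)
      have "\<bar>est h n \<omega> x - f x\<bar> < f x * e" using nD w by (auto simp: D_def)
      then have "est h n \<omega> x \<le> (1 + e) * f x" by (simp add: distrib_right mult.commute[of e])
      then have "sqrt (est h n \<omega> x * kp) \<le> sqrt (((1 + e) * f x) * kp)"
        using kp by (intro real_sqrt_le_mono mult_right_mono) auto
      then have "sqrt (est h n \<omega> x * kp) * lam n \<le> sqrt (((1 + e) * f x) * kp) * (sqrt 2 * sqrt (1 + e))"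
        using elim(3,4) fx e kp by (intro mult_mono) auto
      also have "\<dots> = (1 + e) * sqrt (2 * kp * f x)"
        using e by (simp add: real_sqrt_mult)
      finally have "tau n * (sqrt (est h n \<omega> x * kp) * lam n) \<le> tau n * ((1 + e) * sqrt (2 * kp * f x))"
        using tau by (intro mult_left_mono) auto
      also have "\<dots> < est hs n \<omega> x - f x" using A by (simp add: A_def kp_def)
      finally show "miss lam n \<omega> x" by (simp add: miss_def kp_def)
    qed
    have half: "2 * exp (- b n) \<le> 1 / 2"
    proof -
      have "exp (- b n) \<le> exp (- ln 4)" using elim(5) by (intro exp_mono) simp
      then show ?thesis by (simp add: exp_minus)
    qed
    have "exp (- b n * (1 + 5 * e)) \<le> exp (- ln 2 + - b n * r)"
    proof (rule exp_mono)
      have "ln 2 \<le> b n * e" using elim(5) e by (simp add: pos_divide_le_eq)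
      \<comment> \<open>r + e = 1 + 4 e + e^2 and e < 1: this is the origin of the factor 5.\<close>
      moreover have "b n * (r + e) \<le> b n * (1 + 5 * e)"
        using bp e by (intro mult_left_mono) (auto simp: r_def power2_eq_square algebra_simps mult_left_le)
      ultimately show "- b n * (1 + 5 * e) \<le> - ln 2 + - b n * r" by (simp add: algebra_simps)
    qed
    also have "\<dots> = exp (- b n * r) * (1 / 2)" by (simp only: exp_add) (simp add: exp_minus)
    also have "\<dots> \<le> exp (- b n * r) * (1 - 2 * exp (- b n))" using half by (intro mult_left_mono) auto
    also have "\<dots> = exp (- b n * r) - 2 * (exp (- b n * r) * exp (- b n))" by (simp add: right_diff_distrib)
    also have "exp (- b n * r) * exp (- b n) = exp (- b n * (r + 1))" by (simp add: distrib_left flip: exp_add)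
    also have "exp (- b n * r) - 2 * exp (- b n * (r + 1)) \<le> prob A - prob D"
      using elim(1) elim(2)[rule_format, of x] unfolding A_def D_def r_def by linarith
    also have "\<dots> \<le> prob (A - D)"
    proof -
      have "prob A \<le> prob ((A - D) \<union> D)" using meas by (intro finite_measure_mono) auto
      also have "\<dots> \<le> prob (A - D) + prob D" using meas by (intro measure_Un_le) auto
      finally show ?thesis by simp
    qed
    also have "\<dots> \<le> prob {\<omega> \<in> space M. miss lam n \<omega> x}" using sub by (rule finite_measure_mono) (rule miss_set)
    finally show ?case .
  qed
qed

text \<open>Apart from sqrt 2, all terms form one constant divided by log (1/h). The limit is the
  same for every quantile and every length of the interval.\<close>

lemma normalised_band_l_lim: "(\<lambda>n. band_l K c1 c2 z (h n) / sqrt (ln (1 / h n))) \<longlonglongrightarrow> sqrt 2"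
proof -
  define c where "c = ln (1 / (2 * pi) * sqrt (kernel_deriv_sq K / kernel_sq K)) + ln ((c2 - c1) / pi)"
  have "(\<lambda>n. sqrt 2 + (c + z) / sqrt 2 * (1 / (a * ln n))) \<longlonglongrightarrow> sqrt 2 + (c + z) / sqrt 2 * 0"
    by (intro tendsto_intros) (use a in real_asymp)
  moreover have "\<forall>\<^sub>F n in sequentially. sqrt 2 + (c + z) / sqrt 2 * (1 / (a * ln n)) = band_l K c1 c2 z (h n) / sqrt (ln (1 / h n))"
    using ev_ge[of 2]
  proof eventually_elim
    case (elim n)
    define t where "t = ln (1 / h n)"
    have t: "a * ln n = t" "0 < t" using elim ln_inverse_h[of n] a by (auto simp: t_def)
    show ?case
      unfolding band_l_def band_u_def c_def[symmetric] t_def[symmetric] t(1) using t(2)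
      by (simp add: add_divide_distrib distrib_right)
  qed
  ultimately show ?thesis by (simp add: tendsto_cong)
qed

lemma not_in_conf_interval:
  assumes n: "2 \<le> n"
  shows "f x \<notin> conf_interval K c1 c2 z (h n) (hs n) n (\<lambda>j. X j \<omega>) x
    \<longleftrightarrow> miss (\<lambda>n. band_l K c1 c2 z (h n) / sqrt (ln (1 / h n))) n \<omega> x"
proof -
  have "0 < ln (1 / h n)" using ln_inverse_h[of n] a n by simp
  then have r: "tau n * (sqrt (est h n \<omega> x * kernel_sq K) * (band_l K c1 c2 z (h n) / sqrt (ln (1 / h n))))
     = sqrt (est h n \<omega> x * kernel_sq K) / sqrt (n * h n) * band_l K c1 c2 z (h n)"
    using tau_alt[of n] n by simp
  \<comment> \<open>This also covers a negative half-width, for which the interval is empty.\<close>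
  have "u \<notin> {v - r..v + r} \<longleftrightarrow> r < \<bar>v - u\<bar>" for u v r :: real by auto
  then show ?thesis unfolding miss_def r conf_interval_def by simp
qed

end

theorem mainTheorem6:
  fixes M :: "'a measure" and X :: "nat \<Rightarrow> 'a \<Rightarrow> real"
    and f f' f'' K :: "real \<Rightarrow> real" and c1 c2 a \<alpha> z :: real and h hs :: "nat \<Rightarrow> real"
  assumes M: "prob_space M"
    and X_indep: "prob_space.indep_vars M (\<lambda>_. borel) X {1..}"
    and X_density: "\<And>j. j \<ge> 1 \<Longrightarrow> distributed M lborel (X j) (\<lambda>x. ennreal (f x))"
    and f_nonneg: "\<And>x. f x \<ge> 0"
    and f_bounded: "bounded (range f)"
    and C: "c1 < c2"
    and f_away: "\<exists>\<delta>>0. \<forall>x\<in>{c1..c2}. \<delta> \<le> f x"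
    and K_lim: "(K \<longlongrightarrow> 0) at_infinity"
    and K_bounded: "bounded (range K)"
    and K_nonneg: "\<And>x. K x \<ge> 0"
    and K_int: "has_bochner_integral lborel K 1"
    and K_int1: "has_bochner_integral lborel (\<lambda>x. x * K x) 0"
    and K_int2: "integrable lborel (\<lambda>x. x\<^sup>2 * \<bar>K x\<bar>)"
    and K_ac: "abs_continuous_on UNIV K"
    and K_deriv_int: "integrable lborel (\<lambda>t. (deriv K t)\<^sup>2)"
    and K_deriv_pos: "0 < (LINT t|lborel. (deriv K t)\<^sup>2)"
    and K_hoelder: "hoelder_continuous_on UNIV K"
    and K_cov: "covering_number_condition K"
    and f_deriv: "\<And>x. (f has_real_derivative f' x) (at x)"
    and f_deriv2: "\<And>x. (f' has_real_derivative f'' x) (at x)"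
    and f'_bounded: "bounded (range f')"
    and f''_bounded: "bounded (range f'')"
    and a: "1/5 < a" "a < 1/2"
    and h: "\<And>n. h n = real n powr (- a)"
    and hs_pos: "\<And>n. n \<ge> 1 \<Longrightarrow> hs n > 0"
    and hs_lower: "filterlim (\<lambda>n. real n powr a * hs n) at_top sequentially"
    and hs_upper: "(\<lambda>n. real n powr (1 - a) * hs n ^ 4 / ln (real n)) \<longlonglongrightarrow> 0"
    and \<alpha>: "0 < \<alpha>" "\<alpha> < 1"
    and z: "exp (- 2 * exp (- z)) = 1 - \<alpha>"
  shows "(\<forall>x\<in>{c1..c2}.
            (\<lambda>n. h n / (hs n * ln (1 / h n)) *
                 ln (measure M {\<omega> \<in> space M.
                       f x \<notin> conf_interval K c1 c2 z (h n) (hs n) n (\<lambda>j. X j \<omega>) x})) \<longlonglongrightarrow> -1)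
       \<and> (\<lambda>n. h n / (hs n * ln (1 / h n)) *
              ln (measure M {\<omega> \<in> space M. \<exists>x\<in>{c1..c2}.
                    f x \<notin> conf_interval K c1 c2 z (h n) (hs n) n (\<lambda>j. X j \<omega>) x})) \<longlonglongrightarrow> -1
       \<and> (\<lambda>n. h n / (hs n * ln (1 / h n)) *
              ln (measure M {\<omega> \<in> space M. \<exists>x\<in>{c1..c2}.
                    (x, f x) \<notin> conf_band K c1 c2 z (h n) (hs n) n (\<lambda>j. X j \<omega>)})) \<longlonglongrightarrow> -1"
proof -
  have bound: "\<exists>b. \<forall>x. \<bar>g x\<bar> \<le> b" if "bounded (range g)" for g :: "real \<Rightarrow> real"
    using that by (simp add: bounded_iff)
  obtain B0 B1 B2 B3 where B: "\<And>x. \<bar>f x\<bar> \<le> B0" "\<And>x. \<bar>f' x\<bar> \<le> B1" "\<And>x. \<bar>f'' x\<bar> \<le> B2" "\<And>x. \<bar>K x\<bar> \<le> B3"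
    using bound[OF f_bounded] bound[OF f'_bounded] bound[OF f''_bounded] bound[OF K_bounded] by blast
  define B where "B = max 1 (max (max B0 B1) (max B2 B3))"
  have Ble: "1 \<le> B" "B0 \<le> B" "B1 \<le> B" "B2 \<le> B" "B3 \<le> B" by (auto simp: B_def)
  interpret D: kernel_density_bandwidths M X f f' f'' K B a hs
  proof (intro kernel_density_bandwidths.intro kernel_density.intro kernel_density_axioms.intro bandwidths.intro M)
    show "f x \<le> B" "\<bar>f' x\<bar> \<le> B" "\<bar>f'' x\<bar> \<le> B" "K x \<le> B" for x
      using B(1)[of x] B(2)[of x] B(3)[of x] B(4)[of x] Ble by linarith+
    show "0 < a" "a < 1 / 2" using a by simp_all
  qed (assumption | rule X_indep X_density f_nonneg K_nonneg K_int K_int1 K_int2 f_deriv f_deriv2 Ble(1)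
      hs_pos hs_lower hs_upper)+
  obtain \<beta> L where \<beta>: "0 < \<beta>" and hoelder: "\<And>x y. \<bar>K x - K y\<bar> \<le> L * \<bar>x - y\<bar> powr \<beta>"
    using K_hoelder unfolding hoelder_continuous_on_def by auto
  have K_cont: "continuous_on UNIV K"
    by (rule hoelder_imp_continuous[OF \<beta> hoelder])
  obtain d where d: "0 < d" "\<And>x. x \<in> {c1..c2} \<Longrightarrow> d \<le> f x" using f_away by blast
  have h_eq: "h = D.h" by (rule ext) (simp add: h D.h_def)
  define lam where "lam = (\<lambda>n. band_l K c1 c2 z (D.h n) / sqrt (ln (1 / D.h n)))"
  have lam: "lam \<longlonglongrightarrow> sqrt 2" unfolding lam_def by (rule D.normalised_band_l_lim)
  note miss = D.not_in_conf_interval[of _ _ c1 c2 z, folded lam_def]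
  define P where "P x n = measure M {\<omega> \<in> space M. D.miss lam n \<omega> x}" for x n
  define U where "U n = measure M {\<omega> \<in> space M. \<exists>x\<in>{c1..c2}. D.miss lam n \<omega> x}" for n
  \<comment> \<open>This monotonicity sandwiches both probabilities: the upper bound for
    \<open>U\<close> serves every \<open>P x\<close>, and the lower bound at one point serves
    \<open>U\<close>.\<close>
  have PU: "P x n \<le> U n" if "x \<in> {c1..c2}" for x n
    unfolding P_def U_def
    by (rule D.finite_measure_mono[OF _ D.uniform_miss_set[OF C K_cont]]) (use that in auto)
  have upper: "\<forall>\<^sub>F n in sequentially. U n \<le> exp (- D.b n * (1 - 5 * e))" if "0 < e" "e < 1" for e
    unfolding U_def by (rule D.uniform_upper[OF C \<beta> hoelder d lam that])
  have lower: "\<forall>\<^sub>F n in sequentially. exp (- D.b n * (1 + 5 * e)) \<le> P x n"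
    if "0 < e" "e < 1" "x \<in> {c1..c2}" for e x
    unfolding P_def by (rule D.pointwise_lower[OF _ lam that(1,2)]) (use d(1) d(2)[OF that(3)] in linarith)
  have limP: "(\<lambda>n. 1 / D.b n * ln (P x n)) \<longlonglongrightarrow> -1" if x: "x \<in> {c1..c2}" for x
  proof (rule filterlim_log_level[OF D.b_lim])
    show "\<forall>\<^sub>F n in sequentially. P x n \<le> exp (- D.b n * (1 - 5 * e))" if "0 < e" "e < 1" for e
      using upper[OF that] by eventually_elim (rule order_trans[OF PU[OF x]])
  qed (use lower[OF _ _ x] in simp_all)
  have limU: "(\<lambda>n. 1 / D.b n * ln (U n)) \<longlonglongrightarrow> -1"
  proof (rule filterlim_log_level[OF D.b_lim])
    show "\<forall>\<^sub>F n in sequentially. exp (- D.b n * (1 + 5 * e)) \<le> U n" if "0 < e" "e < 1" for e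
    proof -
      have c1: "c1 \<in> {c1..c2}" using C by simp
      show ?thesis using lower[OF that c1] by eventually_elim (rule order_trans[OF _ PU[OF c1]])
    qed
  qed (use upper in simp_all)
  have speed: "\<forall>\<^sub>F n in sequentially. 1 / D.b n * ln (q n) = h n / (hs n * ln (1 / h n)) * ln (q n)" for q
    using D.ev_ge[of 1] by eventually_elim (simp only: h_eq D.b_eq')
  have evP: "\<forall>\<^sub>F n in sequentially. P x n = measure M {\<omega> \<in> space M.
      f x \<notin> conf_interval K c1 c2 z (h n) (hs n) n (\<lambda>j. X j \<omega>) x}" for x
    using D.ev_ge[of 2] by eventually_elim (simp only: P_def h_eq miss)
  have evU: "\<forall>\<^sub>F n in sequentially. U n = measure M {\<omega> \<in> space M. \<exists>x\<in>{c1..c2}.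
      f x \<notin> conf_interval K c1 c2 z (h n) (hs n) n (\<lambda>j. X j \<omega>) x}"
    using D.ev_ge[of 2] by eventually_elim (simp only: U_def h_eq miss)
  \<comment> \<open>The segments are indexed by their first coordinate, so the slice of the band
    over x is the interval at x.\<close>
  have band: "(\<exists>x\<in>{c1..c2}. (x, f x) \<notin> conf_band K c1 c2 z (h n) (hs n) n Y)
      \<longleftrightarrow> (\<exists>x\<in>{c1..c2}. f x \<notin> conf_interval K c1 c2 z (h n) (hs n) n Y x)" for n Y
    unfolding conf_band_def by auto
  have 1: "(\<lambda>n. h n / (hs n * ln (1 / h n)) * ln (measure M {\<omega> \<in> space M.
      f x \<notin> conf_interval K c1 c2 z (h n) (hs n) n (\<lambda>j. X j \<omega>) x})) \<longlonglongrightarrow> -1" if "x \<in> {c1..c2}" for x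
  proof (rule Lim_transform_eventually[OF limP[OF that]])
    show "\<forall>\<^sub>F n in sequentially. 1 / D.b n * ln (P x n) = h n / (hs n * ln (1 / h n)) * ln (measure M {\<omega> \<in> space M.
      f x \<notin> conf_interval K c1 c2 z (h n) (hs n) n (\<lambda>j. X j \<omega>) x})"
      using speed[of "P x"] evP[of x] by eventually_elim (simp only:)
  qed
  have 2: "(\<lambda>n. h n / (hs n * ln (1 / h n)) * ln (measure M {\<omega> \<in> space M. \<exists>x\<in>{c1..c2}.
      f x \<notin> conf_interval K c1 c2 z (h n) (hs n) n (\<lambda>j. X j \<omega>) x})) \<longlonglongrightarrow> -1"
  proof (rule Lim_transform_eventually[OF limU])
    show "\<forall>\<^sub>F n in sequentially. 1 / D.b n * ln (U n) = h n / (hs n * ln (1 / h n)) * ln (measure M {\<omega> \<in> space M. \<exists>x\<in>{c1..c2}.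
      f x \<notin> conf_interval K c1 c2 z (h n) (hs n) n (\<lambda>j. X j \<omega>) x})"
      using speed[of U] evU by eventually_elim (simp only:)
  qed
  show ?thesis unfolding band using 1 2 by blast
qed

end
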